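(* Let $q\in[0,1]$, $L\ge 0$, and let $\mathcal{H}$ be a reproducing kernel Hilbert space of real functions on $\mathcal{X}\times[Y_{\min},Y_{\max}]$ with kernel $k$. Consider the online quantile protocol in the context, run for $T$ rounds, in which the forecaster uses the Online Conditional Quantile Estimation algorithm with kernel $k$ and level $q$, and in which at every round the outcome $y_t$ is drawn from an $L$-Lipschitz distribution $\Delta^y_t$ on $(Y_{\min},Y_{\max}]$. Then for all $f\in\mathcal{H}$, $$\left|\sum_{t=1}^T\mathbb{E}_{p_t\sim\Delta^p_t,\,y_t\sim\Delta^y_t}\big[f(x_t,p_t)\,(\mathbf{1}\{y_t\le p_t\}-q)\big]\right|\le\|f\|_{\mathcal{H}}\sqrt{L+\sum_{t=1}^T\mathbb{E}_{p_t\sim\Delta^p_t,\,y_t\sim\Delta^y_t}\,k\big((x_t,p_t),(x_t,p_t)\big)} .$$ In particular, if $k((x,p),(x',p'))=\Phi(x,p)^\top\Phi(x',p')$ for an explicit finite-dimensional feature map $\Phi$ with $\sup_{(x,p)}\|\Phi(x,p)\|_2^2\le M$, then for any $f(x,p)=\langle v,\Phi(x,p)\rangle$ with $v$ a fixed vector, $$\left|\sum_{t=1}^T\mathbb{E}_{p_t\sim\Delta^p_t,\,y_t\sim\Delta^y_t}\big[f(x_t,p_t)\,(\mathbf{1}\{y_t\le p_t\}-q)\big]\right|\le\|v\|_2\sqrt{L+MT}.$$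
   Context: Protocol. At each round $t$: a context $x_t\in\mathcal{X}$ is chosen arbitrarily (possibly depending on the history); the forecaster, having seen $x_t$ and the history, selects a distribution $\Delta^p_t$ over forecasts in $[Y_{\min},Y_{\max}]$; Nature, knowing $\Delta^p_t$, $x_t$ and the history, selects a distribution $\Delta^y_t$ on $(Y_{\min},Y_{\max}]$; then $p_t\sim\Delta^p_t$ and $y_t\sim\Delta^y_t$ are drawn independently (given the history, $x_t$ and the chosen distributions) and revealed. Expectations are total expectations over all the randomness of the interaction. A distribution $\Delta$ is $L$-Lipschitz if $|\Pr_{y\sim\Delta}[y\le v]-\Pr_{y\sim\Delta}[y\le v']|\le L|v-v'|$ for all $v,v'$. Online Conditional Quantile Estimation algorithm. At round $t$, define $S_t(p)=\sum_{i=1}^{t-1}k((x_t,p),(x_i,p_i))(\mathbf{1}\{y_i\le p_i\}-q)$ (so $S_1\equiv 0$). (i) If $S_t(Y_{\min})\ge 0$, predict $p_t=Y_{\min}$. (ii) Otherwise, if $S_t(Y_{\max})\le 0$, predict $p_t=Y_{\max}$. (iii) Otherwise, find points $p_{t,1},p_{t,2}\in[Y_{\min},Y_{\max}]$ with $S_t(p_{t,1})<0<S_t(p_{t,2})$ and $|p_{t,1}-p_{t,2}|\le \frac{1}{10t^2|S_t(p_{t,1})|}$; set $\tau=\frac{|S_t(p_{t,2})|}{|S_t(p_{t,1})|+|S_t(p_{t,2})|}$; predict $p_t=p_{t,1}$ with probability $\tau$ and $p_t=p_{t,2}$ with probability $1-\tau$. It is assumed that the points required in step (iii) exist and are found whenever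 step (iii) is reached. *)

theory Defs
  imports "HOL-Probability.Probability"
begin

(* A real reproducing kernel Hilbert space of functions on the set Z, with carrier H, inner
   product ip and kernel k. A function on Z is represented by the total function that is 0
   outside Z; this keeps H closed under pointwise addition and scaling and makes equality in H
   the same as equality on Z. Nothing is required of ip outside H or of k outside Z. *)
locale rkhs =
  fixes Z :: "'z set"
    and H :: "('z \<Rightarrow> real) set"
    and ip :: "('z \<Rightarrow> real) \<Rightarrow> ('z \<Rightarrow> real) \<Rightarrow> real"
    and k :: "'z \<Rightarrow> 'z \<Rightarrow> real"
  assumes zero_outside: "\<And>f z. f \<in> H \<Longrightarrow> z \<notin> Z \<Longrightarrow> f z = 0"
    and zero_mem: "(\<lambda>z. 0) \<in> H"
    and add_mem: "\<And>f g. f \<in> H \<Longrightarrow> g \<in> H \<Longrightarrow> (\<lambda>z. f z + g z) \<in> H"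
    and scale_mem: "\<And>c f. f \<in> H \<Longrightarrow> (\<lambda>z. c * f z) \<in> H"
    and ip_commute: "\<And>f g. f \<in> H \<Longrightarrow> g \<in> H \<Longrightarrow> ip f g = ip g f"
    and ip_add: "\<And>f g h. f \<in> H \<Longrightarrow> g \<in> H \<Longrightarrow> h \<in> H \<Longrightarrow> ip (\<lambda>z. f z + g z) h = ip f h + ip g h"
    and ip_scale: "\<And>c f h. f \<in> H \<Longrightarrow> h \<in> H \<Longrightarrow> ip (\<lambda>z. c * f z) h = c * ip f h"
    and ip_nonneg: "\<And>f. f \<in> H \<Longrightarrow> 0 \<le> ip f f"
    and ip_definite: "\<And>f. f \<in> H \<Longrightarrow> ip f f = 0 \<Longrightarrow> f = (\<lambda>z. 0)"
    and complete:
      "\<And>F. (\<And>n. F n \<in> H) \<Longrightarrow>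
        (\<And>e. e > 0 \<Longrightarrow> \<exists>N. \<forall>m\<ge>N. \<forall>n\<ge>N.
            sqrt (ip (\<lambda>z. F m z - F n z) (\<lambda>z. F m z - F n z)) < e) \<Longrightarrow>
        \<exists>g\<in>H. (\<lambda>n::nat. sqrt (ip (\<lambda>z. F n z - g z) (\<lambda>z. F n z - g z))) \<longlonglongrightarrow> 0"
    and kernel_mem: "\<And>z. z \<in> Z \<Longrightarrow> (\<lambda>w. if w \<in> Z then k z w else 0) \<in> H"
    and reproducing:
      "\<And>f z. f \<in> H \<Longrightarrow> z \<in> Z \<Longrightarrow> ip f (\<lambda>w. if w \<in> Z then k z w else 0) = f z"

definition rkhs_norm :: "(('z \<Rightarrow> real) \<Rightarrow> ('z \<Rightarrow> real) \<Rightarrow> real) \<Rightarrow> ('z \<Rightarrow> real) \<Rightarrow> real" where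
  "rkhs_norm ip f = sqrt (ip f f)"

definition lipschitz_distribution :: "real \<Rightarrow> real measure \<Rightarrow> bool" where
  "lipschitz_distribution L D \<longleftrightarrow>
     (\<forall>v v'. \<bar>\<P>(u in D. u \<le> v) - \<P>(u in D. u \<le> v')\<bar> \<le> L * \<bar>v - v'\<bar>)"

abbreviation forecast_space :: "real \<Rightarrow> real \<Rightarrow> real measure" where
  "forecast_space Ymin Ymax \<equiv> restrict_space borel {Ymin..Ymax}"

abbreviation outcome_space :: "real \<Rightarrow> real \<Rightarrow> real measure" where
  "outcome_space Ymin Ymax \<equiv> restrict_space borel {Ymin<..Ymax}"

(* The T-round interaction, realised on an arbitrary probability space M.
   G t is the information available once x_t has been revealed (the history of rounds < t, x_t,
   and any private randomness used so far); F t additionally contains Nature's choice in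
   round t. Contexts and both players' choices are thus arbitrary functions of the past, possibly
   randomised. X serves only as a measurable space; the set of contexts is space X.
   The last assumption says that, given F t, the pair (p_t, y_t) has the law
   Dp_t \<Otimes> Dy_t. *)
locale online_quantile_protocol = prob_space M + filtration "space M" G
  for M :: "'w measure" and G :: "nat \<Rightarrow> 'w measure" +
  fixes F :: "nat \<Rightarrow> 'w measure"
    and X :: "'x measure"
    and Ymin Ymax :: real
    and T :: nat
    and x :: "nat \<Rightarrow> 'w \<Rightarrow> 'x"
    and Dp Dy :: "nat \<Rightarrow> 'w \<Rightarrow> real measure"
    and p y :: "nat \<Rightarrow> 'w \<Rightarrow> real"
  assumes subalgebra_G: "\<And>t. subalgebra M (G t)"
    and subalgebra_F: "\<And>t. t \<in> {1..T} \<Longrightarrow> subalgebra M (F t)"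
    and G_le_F: "\<And>t. t \<in> {1..T} \<Longrightarrow> sets (G t) \<subseteq> sets (F t)"
    and F_le_G_Suc: "\<And>t. t \<in> {1..T} \<Longrightarrow> sets (F t) \<subseteq> sets (G (Suc t))"
    and context_choice: "\<And>t. t \<in> {1..T} \<Longrightarrow> x t \<in> G t \<rightarrow>\<^sub>M X"
    and forecaster_choice:
      "\<And>t. t \<in> {1..T} \<Longrightarrow> Dp t \<in> G t \<rightarrow>\<^sub>M prob_algebra (forecast_space Ymin Ymax)"
    and nature_choice:
      "\<And>t. t \<in> {1..T} \<Longrightarrow> Dy t \<in> F t \<rightarrow>\<^sub>M prob_algebra (outcome_space Ymin Ymax)"
    and forecast_revealed:
      "\<And>t. t \<in> {1..T} \<Longrightarrow> p t \<in> G (Suc t) \<rightarrow>\<^sub>M forecast_space Ymin Ymax"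
    and outcome_revealed:
      "\<And>t. t \<in> {1..T} \<Longrightarrow> y t \<in> G (Suc t) \<rightarrow>\<^sub>M outcome_space Ymin Ymax"
    and independent_draws:
      "\<And>t A B. t \<in> {1..T} \<Longrightarrow> A \<in> sets (forecast_space Ymin Ymax) \<Longrightarrow>
        B \<in> sets (outcome_space Ymin Ymax) \<Longrightarrow>
        AE \<omega> in M. real_cond_exp M (F t) (indicator {\<omega> \<in> space M. p t \<omega> \<in> A \<and> y t \<omega> \<in> B}) \<omega>
                    = measure (Dp t \<omega>) A * measure (Dy t \<omega>) B"

definition ocqe_score ::
  "('x \<times> real \<Rightarrow> 'x \<times> real \<Rightarrow> real) \<Rightarrow> real \<Rightarrow>
   (nat \<Rightarrow> 'x) \<Rightarrow> (nat \<Rightarrow> real) \<Rightarrow> (nat \<Rightarrow> real) \<Rightarrow> nat \<Rightarrow> real \<Rightarrow> real" where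
  "ocqe_score k q xs ps ys t u =
     (\<Sum>i\<in>{1..<t}. k (xs t, u) (xs i, ps i) * (of_bool (ys i \<le> ps i) - q))"

definition two_point :: "real \<Rightarrow> real \<Rightarrow> real \<Rightarrow> real \<Rightarrow> real \<Rightarrow> real measure" where
  "two_point Ymin Ymax \<tau> p1 p2 =
     distr (measure_pmf (bernoulli_pmf \<tau>)) (forecast_space Ymin Ymax) (\<lambda>b. if b then p1 else p2)"

(* D is a forecast distribution that Online Conditional Quantile Estimation may play in round t
   when S is the current score function. The search for the two points is not specified, so
   this is a relation; in the third case it also says that suitable points exist. *)
definition ocqe_step ::
  "real \<Rightarrow> real \<Rightarrow> nat \<Rightarrow> (real \<Rightarrow> real) \<Rightarrow> real measure \<Rightarrow> bool" where
  "ocqe_step Ymin Ymax t S D \<longleftrightarrow>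
     (if S Ymin \<ge> 0 then D = return (forecast_space Ymin Ymax) Ymin
      else if S Ymax \<le> 0 then D = return (forecast_space Ymin Ymax) Ymax
      else \<exists>p1\<in>{Ymin..Ymax}. \<exists>p2\<in>{Ymin..Ymax}.
             S p1 < 0 \<and> 0 < S p2 \<and> \<bar>p1 - p2\<bar> \<le> 1 / (10 * (real t)\<^sup>2 * \<bar>S p1\<bar>) \<and>
             D = two_point Ymin Ymax (\<bar>S p2\<bar> / (\<bar>S p1\<bar> + \<bar>S p2\<bar>)) p1 p2)"

definition ennreal_sqrt :: "ennreal \<Rightarrow> ennreal" where
  "ennreal_sqrt a = (if a = \<infinity> then \<infinity> else ennreal (sqrt (enn2real a)))"

end

theory Submission
  imports Defs
begin

text \<open>Write \<open>e t = of_bool (y t \<le> p t) - q\<close> and \<open>z t = (x t, p t)\<close>. By the reproducing property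
  \<open>(\<Sum>t. e t * f (z t))\<^sup>2 \<le> \<parallel>f\<parallel>\<^sup>2 * Q\<close> with \<open>Q = (\<Sum>s. \<Sum>t. e s * e t * k (z s) (z t))\<close>, so by
  Jensen's inequality it suffices to bound the expectation of \<open>Q\<close>. Splitting off the diagonal,
  \<open>Q = (\<Sum>t. (e t)\<^sup>2 * k (z t) (z t)) + 2 * (\<Sum>t. e t * S t (p t))\<close>, and the algorithm plays so that
  the conditional expectation of \<open>e t * S t (p t)\<close> is at most \<open>L / (10 * t\<^sup>2)\<close>; these terms sum to
  at most \<open>L / 2\<close>.

  The feature-map bound is an instance: replacing \<open>v\<close> by its orthogonal projection to the span of
  the features does not change \<open>f\<close> and makes it a combination of kernel sections, hence a member of
  \<open>H\<close> of norm at most \<open>\<parallel>v\<parallel>\<close>.\<close>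

section \<open>Finite measures on products, determined by their values on boxes\<close>

lemma finite_pair_measure_eqI:
  assumes fin: "finite_measure \<mu>"
    and sets: "sets \<mu> = sets (A \<Otimes>\<^sub>M B)" "sets \<nu> = sets (A \<Otimes>\<^sub>M B)"
    and eq: "\<And>a b. a \<in> sets A \<Longrightarrow> b \<in> sets B \<Longrightarrow> emeasure \<mu> (a \<times> b) = emeasure \<nu> (a \<times> b)"
  shows "\<mu> = \<nu>"
proof (rule measure_eqI_generator_eq[OF Int_stable_pair_measure_generator[of A B] pair_measure_closed])
  \<comment> \<open>Since the total mass is finite, the constant sequence of the whole space already
    serves as the exhaustion by sets of finite measure.\<close>
  show "range (\<lambda>i::nat. space A \<times> space B) \<subseteq> {a \<times> b |a b. a \<in> sets A \<and> b \<in> sets B}"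
    by auto
  show "emeasure \<mu> (space A \<times> space B) \<noteq> \<infinity>"
    using fin by (simp add: finite_measure.emeasure_finite)
qed (use sets eq in \<open>auto simp: sets_pair_measure\<close>)

text \<open>The two-factor case is used twice. For a fixed first side \<open>a\<close>, restricting
  to the strip over \<open>a\<close> and projecting gives a finite measure on \<open>B\<close> times
  \<open>C\<close>; boxes determine it, so the measures agree on \<open>a \<times> d\<close> for
  every measurable \<open>d\<close>, and such sets determine the whole measure.\<close>

lemma finite_triple_measure_eqI:
  assumes fin: "finite_measure \<mu>"
    and sets: "sets \<mu> = sets (A \<Otimes>\<^sub>M (B \<Otimes>\<^sub>M C))" "sets \<nu> = sets (A \<Otimes>\<^sub>M (B \<Otimes>\<^sub>M C))"
    and eq: "\<And>a b c. a \<in> sets A \<Longrightarrow> b \<in> sets B \<Longrightarrow> c \<in> sets C \<Longrightarrow>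
      emeasure \<mu> (a \<times> (b \<times> c)) = emeasure \<nu> (a \<times> (b \<times> c))"
  shows "\<mu> = \<nu>"
proof (rule finite_pair_measure_eqI[OF fin sets])
  fix a d assume a: "a \<in> sets A" and d: "d \<in> sets (B \<Otimes>\<^sub>M C)"
  define slice where
    "slice m = distr (density m (indicator (a \<times> space (B \<Otimes>\<^sub>M C)))) (B \<Otimes>\<^sub>M C) snd"
    for m :: "('a \<times> 'b \<times> 'c) measure"
  have slice: "emeasure (slice m) e = emeasure m (a \<times> e)"
    if m: "sets m = sets (A \<Otimes>\<^sub>M (B \<Otimes>\<^sub>M C))" and e: "e \<in> sets (B \<Otimes>\<^sub>M C)" for m e
  proof -
    note [measurable_cong] = m
    have sp: "space m = space A \<times> space (B \<Otimes>\<^sub>M C)"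
      using sets_eq_imp_space_eq[OF m] by (simp add: space_pair_measure)
    have "emeasure (slice m) e = emeasure (density m (indicator (a \<times> space (B \<Otimes>\<^sub>M C)))) (snd -` e \<inter> space m)"
      unfolding slice_def using e by (subst emeasure_distr) auto
    also have "\<dots> = (\<integral>\<^sup>+z. indicator (a \<times> space (B \<Otimes>\<^sub>M C)) z * indicator (snd -` e \<inter> space m) z \<partial>m)"
      using a measurable_sets[OF measurable_snd' e, of "\<lambda>z. z" m] e
      by (intro emeasure_density) (auto simp: m)
    also have "\<dots> = (\<integral>\<^sup>+z. indicator (a \<times> e) z \<partial>m)"
      using sets.sets_into_space[OF e] sets.sets_into_space[OF a]
      by (intro nn_integral_cong) (auto simp: sp indicator_def)
    finally show ?thesis using a e m by simp
  qed
  have sets_slice: "sets (slice m) = sets (B \<Otimes>\<^sub>M C)" for m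
    by (simp add: slice_def)
  have "slice \<mu> = slice \<nu>"
  proof (rule finite_pair_measure_eqI[OF _ sets_slice sets_slice])
    show "finite_measure (slice \<mu>)"
    proof
      have "emeasure (slice \<mu>) (space (slice \<mu>)) = emeasure \<mu> (a \<times> space (B \<Otimes>\<^sub>M C))"
        by (subst slice[OF sets(1), symmetric]) (simp_all add: slice_def)
      then show "emeasure (slice \<mu>) (space (slice \<mu>)) \<noteq> \<infinity>"
        using fin by (simp add: finite_measure.emeasure_finite)
    qed
  qed (use a eq in \<open>simp add: slice sets\<close>)
  then show "emeasure \<mu> (a \<times> d) = emeasure \<nu> (a \<times> d)"
    using slice[OF sets(1) d] slice[OF sets(2) d] by simp
qed

section \<open>Reproducing kernel Hilbert spaces\<close>

context rkhs
begin

text \<open>The cut-off to 0 outside \<open>Z\<close> matches the representation of members of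
  \<open>H\<close> as total functions.\<close>

definition kernel_section where
  "kernel_section z = (\<lambda>w. if w \<in> Z then k z w else 0)"

lemma kernel_section_mem: "z \<in> Z \<Longrightarrow> kernel_section z \<in> H"
  using kernel_mem by (simp add: kernel_section_def)

lemma ip_kernel_section: "f \<in> H \<Longrightarrow> z \<in> Z \<Longrightarrow> ip f (kernel_section z) = f z"
  using reproducing by (simp add: kernel_section_def)

text \<open>Both sides are the inner product of the same two sections, evaluated by the reproducing
  property in either order; the symmetry is thus inherited from \<open>ip\<close>.\<close>

lemma kernel_commute: "z \<in> Z \<Longrightarrow> w \<in> Z \<Longrightarrow> k z w = k w z"
  using ip_kernel_section[of "kernel_section z" w] ip_kernel_section[of "kernel_section w" z]
    ip_commute[of "kernel_section z" "kernel_section w"]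
  by (simp add: kernel_section_mem) (simp add: kernel_section_def)

lemma lincomb_mem:
  "finite I \<Longrightarrow> (\<And>i. i \<in> I \<Longrightarrow> g i \<in> H) \<Longrightarrow> (\<lambda>w. \<Sum>i\<in>I. c i * g i w) \<in> H"
  by (induction I rule: finite_induct) (auto intro!: zero_mem add_mem scale_mem)

lemma ip_zero: "h \<in> H \<Longrightarrow> ip (\<lambda>z. 0) h = 0"
  using ip_scale[of "\<lambda>z. 0" h 0] zero_mem by simp

lemma ip_lincomb:
  assumes "h \<in> H"
  shows "finite I \<Longrightarrow> (\<And>i. i \<in> I \<Longrightarrow> g i \<in> H) \<Longrightarrow>
    ip (\<lambda>w. \<Sum>i\<in>I. c i * g i w) h = (\<Sum>i\<in>I. c i * ip (g i) h)"
proof (induction I rule: finite_induct)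
  case empty
  then show ?case using assms by (simp add: ip_zero)
next
  case (insert i I)
  then show ?case using assms by (simp add: ip_add ip_scale scale_mem lincomb_mem)
qed

lemma ip_lincomb_right:
  assumes "h \<in> H" "finite I" "\<And>i. i \<in> I \<Longrightarrow> g i \<in> H"
  shows "ip h (\<lambda>w. \<Sum>i\<in>I. c i * g i w) = (\<Sum>i\<in>I. c i * ip h (g i))"
proof -
  have "ip h (\<lambda>w. \<Sum>i\<in>I. c i * g i w) = ip (\<lambda>w. \<Sum>i\<in>I. c i * g i w) h"
    using assms by (intro ip_commute lincomb_mem) auto
  then show ?thesis
    using assms by (simp add: ip_lincomb ip_commute cong: sum.cong)
qed

lemma ip_square_expand:
  assumes f: "f \<in> H" and g: "g \<in> H"
  shows "ip (\<lambda>z. f z + s * g z) (\<lambda>z. f z + s * g z) = ip f f + 2 * s * ip f g + s\<^sup>2 * ip g g"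
proof -
  let ?u = "\<lambda>z. f z + s * g z"
  have u: "?u \<in> H" using f g by (intro add_mem scale_mem)
  have r: "ip ?u h = ip f h + s * ip g h" if "h \<in> H" for h
    using ip_add[OF f scale_mem[OF g] that] ip_scale[OF g that] by simp
  have "ip ?u ?u = ip f ?u + s * ip g ?u" using r u by simp
  also have "\<dots> = ip ?u f + s * ip ?u g" using ip_commute f g u by simp
  also have "\<dots> = (ip f f + s * ip g f) + s * (ip f g + s * ip g g)" using r f g by simp
  finally show ?thesis using ip_commute[OF f g] by (simp add: algebra_simps power2_eq_square)
qed

lemma ip_cauchy_schwarz:
  assumes f: "f \<in> H" and g: "g \<in> H"
  shows "(ip f g)\<^sup>2 \<le> ip f f * ip g g"
proof (cases "ip g g = 0")
  case True
  then have "ip f g = 0"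
    using ip_definite[OF g] ip_commute[OF f g] ip_zero[OF f] by simp
  then show ?thesis using True by simp
next
  case False
  then have pos: "ip g g > 0" using ip_nonneg[OF g] by simp
  \<comment> \<open>The multiplier \<open>- ip f g / ip g g\<close> minimises the quadratic of
    \<open>ip_square_expand\<close> in \<open>s\<close>.\<close>
  have "0 \<le> ip f f + 2 * (- ip f g / ip g g) * ip f g + (- ip f g / ip g g)\<^sup>2 * ip g g"
    using ip_nonneg[OF add_mem[OF f scale_mem[OF g]]] ip_square_expand[OF f g] by metis
  also have "\<dots> = ip f f - (ip f g)\<^sup>2 / ip g g"
    using pos by (simp add: field_simps power2_eq_square)
  finally show ?thesis using pos by (simp add: field_simps)
qed

text \<open>An inner product against a combination of sections is the same combination of point
  values. Taking the combination itself as the other argument turns its squared norm into the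
  quadratic form of the Gram matrix.\<close>

lemma ip_kernel_lincomb:
  fixes c :: "'i \<Rightarrow> real"
  assumes "finite I" "\<And>i. i \<in> I \<Longrightarrow> z i \<in> Z"
  defines "g \<equiv> (\<lambda>w. \<Sum>i\<in>I. c i * kernel_section (z i) w)"
  shows "g \<in> H"
    and "ip g g = (\<Sum>i\<in>I. \<Sum>j\<in>I. c i * c j * k (z i) (z j))"
    and "\<And>f. f \<in> H \<Longrightarrow> ip f g = (\<Sum>i\<in>I. c i * f (z i))"
proof -
  show g: "g \<in> H"
    unfolding g_def using assms by (intro lincomb_mem kernel_section_mem)
  show fg: "ip f g = (\<Sum>i\<in>I. c i * f (z i))" if "f \<in> H" for f
    unfolding g_def using assms that
    by (simp add: ip_lincomb_right kernel_section_mem ip_kernel_section)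
  have "g (z i) = (\<Sum>j\<in>I. c j * k (z i) (z j))" if "i \<in> I" for i
    unfolding g_def using assms that
    by (intro sum.cong) (auto simp: kernel_section_def kernel_commute)
  then show "ip g g = (\<Sum>i\<in>I. \<Sum>j\<in>I. c i * c j * k (z i) (z j))"
    using fg[OF g] by (simp add: sum_distrib_left mult.assoc)
qed

text \<open>Cauchy-Schwarz for \<open>f\<close> and the combination of sections with coefficients
  \<open>c i\<close>. With the errors as coefficients this bounds the squared regret by the
  quadratic form \<open>Q\<close>.\<close>

lemma kernel_quadratic_form_bound:
  assumes "f \<in> H" "finite I" "\<And>i. i \<in> I \<Longrightarrow> z i \<in> Z"
  shows "(\<Sum>i\<in>I. c i * f (z i))\<^sup>2 \<le> ip f f * (\<Sum>i\<in>I. \<Sum>j\<in>I. c i * c j * k (z i) (z j))"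
  using ip_cauchy_schwarz[OF assms(1) ip_kernel_lincomb(1)[OF assms(2,3)]]
    ip_kernel_lincomb(2)[OF assms(2,3)] ip_kernel_lincomb(3)[OF assms(2,3,1)]
  by simp

lemma kernel_nonneg: "z \<in> Z \<Longrightarrow> 0 \<le> k z z"
  using ip_nonneg[OF kernel_section_mem] ip_kernel_section[OF kernel_section_mem]
  by (fastforce simp: kernel_section_def)

lemma point_evaluation_bound: "f \<in> H \<Longrightarrow> z \<in> Z \<Longrightarrow> (f z)\<^sup>2 \<le> ip f f * k z z"
  using kernel_quadratic_form_bound[of f "{()}" "\<lambda>_. z" "\<lambda>_. 1"] by simp

text \<open>Cauchy-Schwarz followed by the inequality of arithmetic and geometric means. The mean is
  linear in the diagonal values, so integrability of the diagonal dominates the off-diagonal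
  terms.\<close>

lemma abs_kernel_le:
  assumes "z \<in> Z" "w \<in> Z"
  shows "\<bar>k z w\<bar> \<le> (k z z + k w w) / 2"
proof -
  have "(k z w)\<^sup>2 \<le> k z z * k w w"
    using point_evaluation_bound[OF kernel_section_mem ] ip_kernel_section[OF kernel_section_mem] assms
    by (fastforce simp: kernel_section_def)
  also have "\<dots> \<le> ((k z z + k w w) / 2)\<^sup>2"
    using zero_le_power2[of "k z z - k w w"] by (simp add: power2_eq_square field_simps)
  finally show ?thesis
    using kernel_nonneg assms by (simp add: abs_le_square_iff[symmetric])
qed

text \<open>A minimising sequence \<open>g n \<in> S\<close> for the distance to \<open>f\<close> converges to \<open>f\<close> pointwise: moving
  \<open>g n\<close> along the section at \<open>z\<close> lowers the squared distance by about
  \<open>(f z - g n z)\<^sup>2 / k z z\<close>, so this quantity tends to 0.\<close>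

lemma subspace_with_kernel_sections:
  assumes S: "S \<subseteq> H" "(\<lambda>z. 0) \<in> S"
    and S_add: "\<And>g c z. g \<in> S \<Longrightarrow> z \<in> Z \<Longrightarrow> (\<lambda>w. g w + c * kernel_section z w) \<in> S"
    and S_lim: "\<And>g h. (\<And>n. g n \<in> S) \<Longrightarrow> h \<in> H \<Longrightarrow> (\<And>z. (\<lambda>n. g n z) \<longlonglongrightarrow> h z) \<Longrightarrow> h \<in> S"
    and f: "f \<in> H"
  shows "f \<in> S"
proof -
  \<comment> \<open>Differences are written with the factor \<open>-1\<close> so that
    \<open>add_mem\<close>, \<open>scale_mem\<close> and \<open>ip_square_expand\<close> apply to
    them as they stand.\<close>
  let ?d = "\<lambda>g. ip (\<lambda>z. f z + (-1) * g z) (\<lambda>z. f z + (-1) * g z)"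
  define D where "D = (INF g\<in>S. ?d g)"
  have diff: "(\<lambda>z. f z + (-1) * g z) \<in> H" if "g \<in> S" for g
    using that S f by (intro add_mem scale_mem) auto
  have bdd: "bdd_below (?d ` S)"
    using ip_nonneg[OF diff] by (intro bdd_belowI[where m = 0]) auto
  have D_le: "D \<le> ?d g" if "g \<in> S" for g
    unfolding D_def using bdd that by (rule cINF_lower)
  have "\<exists>g\<in>S. ?d g < D + 1 / real (Suc n)" for n
  proof -
    have "(INF g\<in>S. ?d g) < D + 1 / real (Suc n)" by (simp add: D_def)
    then show ?thesis using S(2) bdd by (subst (asm) cINF_less_iff) auto
  qed
  then obtain g where g: "\<And>n. g n \<in> S" "\<And>n. ?d (g n) < D + 1 / real (Suc n)"
    by metis
  have bound: "(f z + (-1) * g n z)\<^sup>2 \<le> (k z z + 1) * (1 / real (Suc n))" if z: "z \<in> Z" for n z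
  proof -
    let ?u = "\<lambda>w. f w + (-1) * g n w"
    define a where "a = ?u z"
    define K where "K = k z z"
    have K: "0 \<le> K" unfolding K_def using z by (rule kernel_nonneg)
    \<comment> \<open>This minimises \<open>2 * s * a + s\<^sup>2 * (K + 1)\<close>. Using
      \<open>K + 1\<close> in place of \<open>K\<close> avoids a division by zero when
      \<open>k z z = 0\<close>.\<close>
    define s where "s = - a / (K + 1)"
    have "ip (kernel_section z) (kernel_section z) = K"
      using ip_kernel_section[OF kernel_section_mem] z by (simp add: K_def) (simp add: kernel_section_def)
    moreover have "ip ?u (kernel_section z) = a"
      unfolding a_def by (rule ip_kernel_section[OF diff[OF g(1)] z])
    moreover have "(\<lambda>w. f w + (-1) * (g n w + (- s) * kernel_section z w)) = (\<lambda>w. ?u w + s * kernel_section z w)"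
      by (simp add: algebra_simps)
    ultimately have "?d (\<lambda>w. g n w + (- s) * kernel_section z w) = ?d (g n) + 2 * s * a + s\<^sup>2 * K"
      using ip_square_expand[OF diff[OF g(1)[of n]] kernel_section_mem[OF z], of s] by (simp only:)
    then have pos: "0 < 1 / real (Suc n) + 2 * s * a + s\<^sup>2 * K"
      using D_le[OF S_add[OF g(1) z, of n "-s"]] g(2)[of n] by linarith
    have "2 * s * a + s\<^sup>2 * K \<le> 2 * s * a + s\<^sup>2 * (K + 1)"
      using K by (simp add: mult_left_mono)
    also have "2 * s * a + s\<^sup>2 * (K + 1) = - a\<^sup>2 / (K + 1)"
    proof -
      have "s * (K + 1) = - a" unfolding s_def using K by simp
      then have "s\<^sup>2 * (K + 1) = - (s * a)" by (simp add: power2_eq_square mult.assoc)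
      then show ?thesis by (simp add: s_def power2_eq_square)
    qed
    \<comment> \<open>The step along the section cannot bring the squared distance below the infimum
      \<open>D\<close>, while \<open>g n\<close> is within \<open>1 / real (Suc n)\<close> of it; so
      the decrease is at most that slack.\<close>
    finally have "a\<^sup>2 / (K + 1) \<le> 1 / real (Suc n)" using pos by linarith
    then have "a\<^sup>2 \<le> (K + 1) * (1 / real (Suc n))"
      using K by (subst (asm) pos_divide_le_eq) (simp_all only: mult.commute)
    then show ?thesis by (simp only: a_def K_def)
  qed
  have "(\<lambda>n. g n z) \<longlonglongrightarrow> f z" for z
  proof (cases "z \<in> Z")
    case False
    then have "g n z = 0" "f z = 0" for n
      using zero_outside g(1) S(1) f by auto
    then show ?thesis by simp
  next
    case True
    have "(\<lambda>n. (k z z + 1) * (1 / real (Suc n))) \<longlonglongrightarrow> (k z z + 1) * 0"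
      using LIMSEQ_inverse_real_of_nat by (intro tendsto_mult_left) (simp add: inverse_eq_divide)
    then have upper: "(\<lambda>n. (k z z + 1) * (1 / real (Suc n))) \<longlonglongrightarrow> 0"
      by (simp only: mult_zero_right)
    have "(\<lambda>n. (f z + (-1) * g n z)\<^sup>2) \<longlonglongrightarrow> 0"
      by (rule tendsto_sandwich[OF _ _ tendsto_const upper])
        (use bound[OF True] zero_le_power2 in \<open>blast intro: always_eventually\<close>)+
    then have "(\<lambda>n. \<bar>f z + (-1) * g n z\<bar>) \<longlonglongrightarrow> 0"
      using tendsto_real_sqrt[of "\<lambda>n. (f z + (-1) * g n z)\<^sup>2" 0] by (simp only: real_sqrt_abs real_sqrt_zero)
    then have "(\<lambda>n. f z + (-1) * g n z) \<longlonglongrightarrow> 0"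
      by (rule tendsto_rabs_zero_cancel)
    from tendsto_diff[OF tendsto_const[of "f z"] this] show ?thesis by simp
  qed
  with g(1) f show ?thesis by (rule S_lim)
qed

text \<open>The measurable members of \<open>H\<close> contain the zero function, absorb multiples
  of sections and are closed under pointwise limits, so by
  \<open>subspace_with_kernel_sections\<close> they are all of \<open>H\<close>. Hence measurability
  of the kernel passes to every test function.\<close>

lemma mem_borel_measurable:
  assumes space: "space N = Z"
    and kernel: "\<And>z. z \<in> Z \<Longrightarrow> k z \<in> borel_measurable N"
    and f: "f \<in> H"
  shows "f \<in> borel_measurable N"
proof -
  have "f \<in> {g \<in> H. g \<in> borel_measurable N}"
  proof (rule subspace_with_kernel_sections[OF _ _ _ _ f])
    fix g c z assume g: "g \<in> {g \<in> H. g \<in> borel_measurable N}" and z: "z \<in> Z"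
    have [measurable]: "kernel_section z \<in> borel_measurable N" "g \<in> borel_measurable N"
      using kernel[OF z] g measurable_cong[of N "kernel_section z" "k z" borel]
      by (auto simp: kernel_section_def space)
    show "(\<lambda>w. g w + c * kernel_section z w) \<in> {g \<in> H. g \<in> borel_measurable N}"
      using g z by (auto intro!: add_mem scale_mem kernel_section_mem)
  next
    fix g h assume "\<And>n::nat. g n \<in> {g \<in> H. g \<in> borel_measurable N}" "h \<in> H"
      "\<And>z. (\<lambda>n. g n z) \<longlonglongrightarrow> h z"
    then show "h \<in> {g \<in> H. g \<in> borel_measurable N}"
      by (auto intro: borel_measurable_LIMSEQ_real)
  qed (auto intro: zero_mem)
  then show ?thesis by simp
qed

end

section \<open>The joint law of the information in a round and its two draws\<close>

context online_quantile_protocol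
begin

abbreviation "draw_space \<equiv> forecast_space Ymin Ymax \<Otimes>\<^sub>M outcome_space Ymin Ymax"

lemma draw_kernel:
  assumes t: "t \<in> {1..T}"
  shows "(\<lambda>\<omega>. Dp t \<omega> \<Otimes>\<^sub>M Dy t \<omega>) \<in> F t \<rightarrow>\<^sub>M prob_algebra draw_space"
    and "Dp t \<in> F t \<rightarrow>\<^sub>M prob_algebra (forecast_space Ymin Ymax)"
proof -
  show Dp: "Dp t \<in> F t \<rightarrow>\<^sub>M prob_algebra (forecast_space Ymin Ymax)"
    using forecaster_choice[OF t] G_le_F[OF t] subalgebra_F[OF t] subalgebra_G[of t]
    by (auto simp: measurable_def subalgebra_def)
  show "(\<lambda>\<omega>. Dp t \<omega> \<Otimes>\<^sub>M Dy t \<omega>) \<in> F t \<rightarrow>\<^sub>M prob_algebra draw_space"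
    using Dp nature_choice[OF t] by measurable
qed

lemma nn_integral_draw_measurable:
  assumes t: "t \<in> {1..T}"
    and h: "h \<in> borel_measurable (F t \<Otimes>\<^sub>M draw_space)"
  shows "(\<lambda>\<omega>. \<integral>\<^sup>+z. h (\<omega>, z) \<partial>(Dp t \<omega> \<Otimes>\<^sub>M Dy t \<omega>)) \<in> borel_measurable M"
  using h by (intro measurable_from_subalg[OF subalgebra_F[OF t]]
      nn_integral_measurable_subprob_algebra2[OF _ measurable_prob_algebraD[OF draw_kernel(1)[OF t]]]) simp

text \<open>The law of \<open>(\<omega>, p t \<omega>, y t \<omega>)\<close>, with
  \<open>\<omega>\<close> observed through \<open>F t\<close>, is compared with the mixture of the
  product kernels. The protocol states conditional independence for single rectangles
  \<open>A\<close>, \<open>B\<close>; agreement on boxes \<open>E \<times> (A \<times> B)\<close>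
  upgrades it to equality of measures, so \<open>h\<close> may depend jointly on the past and the
  draws.\<close>

lemma nn_integral_draw:
  assumes t: "t \<in> {1..T}"
    and h: "h \<in> borel_measurable (F t \<Otimes>\<^sub>M draw_space)"
  shows "(\<integral>\<^sup>+\<omega>. h (\<omega>, (p t \<omega>, y t \<omega>)) \<partial>M) = (\<integral>\<^sup>+\<omega>. \<integral>\<^sup>+z. h (\<omega>, z) \<partial>(Dp t \<omega> \<Otimes>\<^sub>M Dy t \<omega>) \<partial>M)"
proof -
  let ?R = "restr_to_subalg M (F t)" and ?N = "F t \<Otimes>\<^sub>M draw_space"
  note sub = subalgebra_F[OF t]
  have space_F: "space (F t) = space M" using sub by (simp add: subalgebra_def)
  note pair = draw_kernel(1)[OF t] and Dp = draw_kernel(2)[OF t] and Dy = nature_choice[OF t]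
  have [measurable]: "p t \<in> M \<rightarrow>\<^sub>M forecast_space Ymin Ymax" "y t \<in> M \<rightarrow>\<^sub>M outcome_space Ymin Ymax"
    using measurable_from_subalg[OF subalgebra_G] forecast_revealed[OF t] outcome_revealed[OF t] by blast+
  have [measurable]: "(\<lambda>\<omega>. \<omega>) \<in> M \<rightarrow>\<^sub>M F t"
    using sub by (auto simp: measurable_def subalgebra_def intro: sets.sets_into_space)
  \<comment> \<open>The kernel keeps a copy of \<open>\<omega>\<close> beside the draw, so that the
    mixture lives on the same space as the joint law.\<close>
  define \<kappa> where "\<kappa> \<omega> = distr (Dp t \<omega> \<Otimes>\<^sub>M Dy t \<omega>) ?N (\<lambda>z. (\<omega>, z))" for \<omega>
  have \<kappa>: "\<kappa> \<in> F t \<rightarrow>\<^sub>M prob_algebra ?N"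
    unfolding \<kappa>_def by (rule measurable_distr_prob_space2[OF pair]) measurable
  have \<kappa>R: "\<kappa> \<in> ?R \<rightarrow>\<^sub>M prob_algebra ?N"
    using measurable_in_subalg[OF sub \<kappa>] .
  have "prob_space ?R" by (rule prob_space_restr_to_subalg[OF sub prob_space_axioms])
  then have R: "?R \<in> space (prob_algebra ?R)" by (simp add: space_prob_algebra)
  define \<mu> where "\<mu> = distr M ?N (\<lambda>\<omega>. (\<omega>, (p t \<omega>, y t \<omega>)))"
  \<comment> \<open>The mixture is formed over \<open>M\<close> restricted to \<open>F t\<close>,
    because \<open>\<kappa>\<close> is a kernel from \<open>F t\<close>.\<close>
  define \<nu> where "\<nu> = ?R \<bind> \<kappa>"
  have sets_kernel: "sets (Dp t \<omega>) = sets (forecast_space Ymin Ymax)" "sets (Dy t \<omega>) = sets (outcome_space Ymin Ymax)"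
     "prob_space (Dp t \<omega>)" "prob_space (Dy t \<omega>)"
    if "\<omega> \<in> space M" for \<omega>
    using measurable_space[OF Dp] measurable_space[OF Dy] that by (auto simp: space_F space_prob_algebra)
  have pair_meas: "Pair \<omega> \<in> Dp t \<omega> \<Otimes>\<^sub>M Dy t \<omega> \<rightarrow>\<^sub>M ?N" if "\<omega> \<in> space M" for \<omega>
    using that sets_pair_measure_cong[OF sets_kernel(1,2)[OF that]] space_F
    by (simp cong: measurable_cong_sets)
  have "\<mu> = \<nu>"
  proof (rule finite_triple_measure_eqI)
    show "finite_measure \<mu>"
      unfolding \<mu>_def by (intro finite_measure_distr) measurable
    show "sets \<mu> = sets ?N" by (simp add: \<mu>_def)
    show "sets \<nu> = sets ?N" unfolding \<nu>_def by (rule sets_bind'[OF R \<kappa>R])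
  next
    fix E A B
    assume E: "E \<in> sets (F t)" and A: "A \<in> sets (forecast_space Ymin Ymax)"
      and B: "B \<in> sets (outcome_space Ymin Ymax)"
    let ?U = "{\<omega> \<in> space M. p t \<omega> \<in> A \<and> y t \<omega> \<in> B}"
    let ?W = "\<lambda>\<omega>. measure (Dp t \<omega>) A * measure (Dy t \<omega>) B"
    have E_M: "E \<in> sets M" using E sub by (auto simp: subalgebra_def)
    have U: "?U \<in> sets M" using A B by measurable
    have W: "?W \<in> borel_measurable (F t)"
      using measurable_measure_prob_algebra[OF A] measurable_measure_prob_algebra[OF B] Dp Dy by measurable
    have WM: "?W \<in> borel_measurable M" using measurable_from_subalg[OF sub W] .
    interpret finite_measure_subalgebra M "F t"
      using sub by unfold_locales
    have W_le: "?W \<omega> \<le> 1" if "\<omega> \<in> space M" for \<omega>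
      using sets_kernel(3,4)[OF that] by (auto intro!: mult_le_one prob_space.prob_le_1)
    have "emeasure \<mu> (E \<times> (A \<times> B)) = emeasure M (E \<inter> ?U)"
      unfolding \<mu>_def using E A B sets.sets_into_space[OF E_M]
      by (subst emeasure_distr) (auto intro!: arg_cong[where f = "emeasure M"])
    also have "\<dots> = ennreal (\<integral>\<omega>. indicator E \<omega> * indicator ?U \<omega> \<partial>M)"
      using E_M U by (simp add: emeasure_eq_measure flip: indicator_inter_arith)
    \<comment> \<open>Defining property of the conditional expectation, for the event
      \<open>E\<close> of \<open>F t\<close>.\<close>
    also have "(\<integral>\<omega>. indicator E \<omega> * indicator ?U \<omega> \<partial>M)
       = (\<integral>\<omega>. indicator E \<omega> * real_cond_exp M (F t) (indicator ?U) \<omega> \<partial>M)"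
      using real_cond_exp_intA[of "indicator ?U" E] E U
      by (simp add: set_lebesgue_integral_def less_top[symmetric])
    also have "\<dots> = (\<integral>\<omega>. indicator E \<omega> * ?W \<omega> \<partial>M)"
      using independent_draws[OF t A B] E_M WM by (intro integral_cong_AE) auto
    also have "ennreal \<dots> = (\<integral>\<^sup>+\<omega>. ennreal (indicator E \<omega> * ?W \<omega>) \<partial>M)"
      using E_M WM W_le by (intro nn_integral_eq_integral[symmetric] integrable_const_bound[where B = 1])
        (auto simp: indicator_def)
    \<comment> \<open>The integrand is measurable for \<open>F t\<close>, so the integral may move
      to the restricted measure that underlies \<open>\<nu>\<close>.\<close>
    also have "\<dots> = (\<integral>\<^sup>+\<omega>. ennreal (indicator E \<omega> * ?W \<omega>) \<partial>?R)"
      using E W by (intro nn_integral_subalgebra2[OF sub, symmetric]) auto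
    also have "\<dots> = (\<integral>\<^sup>+\<omega>. emeasure (\<kappa> \<omega>) (E \<times> (A \<times> B)) \<partial>?R)"
    proof (rule nn_integral_cong)
      fix \<omega> assume "\<omega> \<in> space ?R"
      then have \<omega>: "\<omega> \<in> space M" by (simp add: space_restr_to_subalg)
      interpret P: prob_space "Dp t \<omega>" by (rule sets_kernel(3)[OF \<omega>])
      interpret O: prob_space "Dy t \<omega>" by (rule sets_kernel(4)[OF \<omega>])
      have AB: "A \<in> sets (Dp t \<omega>)" "B \<in> sets (Dy t \<omega>)" using A B sets_kernel[OF \<omega>] by auto
      have "emeasure (\<kappa> \<omega>) (E \<times> (A \<times> B))
          = emeasure (Dp t \<omega> \<Otimes>\<^sub>M Dy t \<omega>) (Pair \<omega> -` (E \<times> (A \<times> B)) \<inter> space (Dp t \<omega> \<Otimes>\<^sub>M Dy t \<omega>))"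
        unfolding \<kappa>_def using E A B by (intro emeasure_distr pair_meas \<omega>) auto
      also have "Pair \<omega> -` (E \<times> (A \<times> B)) \<inter> space (Dp t \<omega> \<Otimes>\<^sub>M Dy t \<omega>) = (if \<omega> \<in> E then A \<times> B else {})"
        using sets.sets_into_space[OF AB(1)] sets.sets_into_space[OF AB(2)]
        by (auto simp: space_pair_measure)
      finally show "ennreal (indicator E \<omega> * ?W \<omega>) = emeasure (\<kappa> \<omega>) (E \<times> (A \<times> B))"
        using AB by (simp add: O.emeasure_pair_measure_Times P.emeasure_eq_measure O.emeasure_eq_measure ennreal_mult)
    qed
    also have "\<dots> = emeasure \<nu> (E \<times> (A \<times> B))"
      unfolding \<nu>_def using E A B by (intro emeasure_bind_prob_algebra[OF R \<kappa>R, symmetric]) auto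
    finally show "emeasure \<mu> (E \<times> (A \<times> B)) = emeasure \<nu> (E \<times> (A \<times> B))" .
  qed
  have "(\<integral>\<^sup>+\<omega>. h (\<omega>, (p t \<omega>, y t \<omega>)) \<partial>M) = (\<integral>\<^sup>+z. h z \<partial>\<mu>)"
    unfolding \<mu>_def using h by (subst nn_integral_distr) auto
  also have "\<dots> = (\<integral>\<^sup>+\<omega>. \<integral>\<^sup>+z. h z \<partial>\<kappa> \<omega> \<partial>?R)"
    unfolding \<open>\<mu> = \<nu>\<close> \<nu>_def by (rule nn_integral_bind[OF h measurable_prob_algebraD[OF \<kappa>R]])
  also have "\<dots> = (\<integral>\<^sup>+\<omega>. \<integral>\<^sup>+z. h z \<partial>\<kappa> \<omega> \<partial>M)"
    using nn_integral_measurable_subprob_algebra2[of "\<lambda>_. h" "F t" ?N \<kappa>] h measurable_prob_algebraD[OF \<kappa>]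
    by (intro nn_integral_subalgebra2[OF sub]) simp
  also have "\<dots> = (\<integral>\<^sup>+\<omega>. \<integral>\<^sup>+z. h (\<omega>, z) \<partial>(Dp t \<omega> \<Otimes>\<^sub>M Dy t \<omega>) \<partial>M)"
    unfolding \<kappa>_def using h pair_meas by (intro nn_integral_cong nn_integral_distr) auto
  finally show ?thesis .
qed

end

section \<open>Integrals under the forecast and outcome distributions of one round\<close>

lemma integral_le_iff_nn_integral_le:
  fixes h :: "'a \<Rightarrow> real"
  assumes h: "integrable N h" and C: "0 \<le> C"
  shows "(\<integral>z. h z \<partial>N) \<le> C \<longleftrightarrow>
    (\<integral>\<^sup>+z. ennreal (h z) \<partial>N) \<le> ennreal C + (\<integral>\<^sup>+z. ennreal (- h z) \<partial>N)"
proof -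
  have "(\<integral>\<^sup>+z. ennreal (h z) \<partial>N) < \<infinity>" "(\<integral>\<^sup>+z. ennreal (- h z) \<partial>N) < \<infinity>"
    using h unfolding real_integrable_def by (auto simp: less_top)
  then obtain a b where "0 \<le> a" "(\<integral>\<^sup>+z. ennreal (h z) \<partial>N) = ennreal a"
      "0 \<le> b" "(\<integral>\<^sup>+z. ennreal (- h z) \<partial>N) = ennreal b"
    by (metis enn2real_nonneg ennreal_enn2real infinity_ennreal_def)
  then show ?thesis
    using C real_lebesgue_integral_def[OF h] by (auto simp flip: ennreal_plus)
qed

text \<open>Fubini, integrating over the outcome first: the indicator becomes the distribution
  function of \<open>E\<close> at the forecast. Domination by \<open>S\<close> itself, as the error
  factor has modulus at most 1, justifies the exchange.\<close>

lemma pair_integral_quantile_loss: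
  fixes D E :: "real measure"
  assumes "prob_space D" "prob_space E"
    and sets: "sets D = sets (restrict_space borel A)" "sets E = sets (restrict_space borel B)"
    and q: "0 \<le> q" "q \<le> 1"
    and S: "integrable D S"
  shows "integrable (D \<Otimes>\<^sub>M E) (\<lambda>(u, v). (of_bool (v \<le> u) - q) * S u)"
    and "(\<integral>z. (case z of (u, v) \<Rightarrow> (of_bool (v \<le> u) - q) * S u) \<partial>(D \<Otimes>\<^sub>M E))
      = (\<integral>u. (\<P>(v in E. v \<le> u) - q) * S u \<partial>D)"
proof -
  interpret D: prob_space D by fact
  interpret E: prob_space E by fact
  interpret pair_prob_space D E ..
  note sets[measurable_cong]
  have id[measurable]: "(\<lambda>u. u) \<in> borel_measurable D" "(\<lambda>u. u) \<in> borel_measurable E"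
    by (auto simp: measurable_cong_sets[OF sets(1) refl] measurable_cong_sets[OF sets(2) refl]
        intro: measurable_restrict_space1)
  have [measurable]: "S \<in> borel_measurable D" using S by simp
  have [measurable]: "Measurable.pred (D \<Otimes>\<^sub>M E) (\<lambda>z. snd z \<le> fst z)"
  proof -
    have [measurable]: "fst \<in> borel_measurable (D \<Otimes>\<^sub>M E)" "snd \<in> borel_measurable (D \<Otimes>\<^sub>M E)"
      using measurable_compose[OF measurable_fst[of D E] id(1)]
        measurable_compose[OF measurable_snd[of D E] id(2)] by simp_all
    show ?thesis by measurable
  qed
  let ?h = "\<lambda>z. (of_bool (snd z \<le> fst z) - q) * S (fst z)"
  have int: "integrable (D \<Otimes>\<^sub>M E) ?h"
  proof (rule Bochner_Integration.integrable_bound)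
    show "integrable (D \<Otimes>\<^sub>M E) (\<lambda>z. S (fst z))"
      using S integrable_distr[OF measurable_fst, of D E S] by (simp add: E.distr_pair_fst)
    show "AE z in D \<Otimes>\<^sub>M E. norm (?h z) \<le> norm (S (fst z))"
      using q by (intro always_eventually) (auto simp: abs_mult intro!: mult_left_le_one_le)
  qed measurable
  then show "integrable (D \<Otimes>\<^sub>M E) (\<lambda>(u, v). (of_bool (v \<le> u) - q) * S u)"
    by (simp add: split_beta')
  have "(\<integral>z. ?h z \<partial>(D \<Otimes>\<^sub>M E)) = (\<integral>u. \<integral>v. (of_bool (v \<le> u) - q) * S u \<partial>E \<partial>D)"
    using integral_fst'[OF int] by simp
  also have "\<dots> = (\<integral>u. (\<P>(v in E. v \<le> u) - q) * S u \<partial>D)"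
  proof (rule Bochner_Integration.integral_cong[OF refl])
    fix u
    have U: "{v \<in> space E. v \<le> u} \<in> sets E" by measurable
    have "(\<integral>v. (of_bool (v \<le> u) - q) * S u \<partial>E) = (\<integral>v. (indicator {v \<in> space E. v \<le> u} v - q) * S u \<partial>E)"
      by (intro Bochner_Integration.integral_cong) (auto simp: indicator_def)
    also have "\<dots> = (\<P>(v in E. v \<le> u) - q) * S u"
      using U by (simp add: E.prob_space less_top[symmetric])
    finally show "(\<integral>v. (of_bool (v \<le> u) - q) * S u \<partial>E) = (\<P>(v in E. v \<le> u) - q) * S u" .
  qed
  finally show "(\<integral>z. (case z of (u, v) \<Rightarrow> (of_bool (v \<le> u) - q) * S u) \<partial>(D \<Otimes>\<^sub>M E))
      = (\<integral>u. (\<P>(v in E. v \<le> u) - q) * S u \<partial>D)"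
    by (simp add: split_beta')
qed

lemma integrable_return:
  fixes g :: "'a \<Rightarrow> real"
  assumes "a \<in> space N" and g: "g \<in> borel_measurable N"
  shows "integrable (return N a) g"
  using assms by (intro integrableI_bounded) (auto simp: nn_integral_return)

lemma two_point_integral:
  fixes g :: "real \<Rightarrow> real"
  assumes p: "p1 \<in> {a..b}" "p2 \<in> {a..b}" and \<tau>: "0 \<le> \<tau>" "\<tau> \<le> 1"
    and g: "g \<in> borel_measurable (forecast_space a b)"
  shows "integrable (two_point a b \<tau> p1 p2) g"
    and "(\<integral>u. g u \<partial>two_point a b \<tau> p1 p2) = \<tau> * g p1 + (1 - \<tau>) * g p2"
proof -
  have m: "(\<lambda>c. if c then p1 else p2) \<in> measure_pmf (bernoulli_pmf \<tau>) \<rightarrow>\<^sub>M forecast_space a b"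
    using p by (auto simp: measurable_def space_restrict_space)
  show "integrable (two_point a b \<tau> p1 p2) g"
    unfolding two_point_def using m g
    by (subst integrable_distr_eq) (auto intro!: integrable_measure_pmf_finite)
  show "(\<integral>u. g u \<partial>two_point a b \<tau> p1 p2) = \<tau> * g p1 + (1 - \<tau>) * g p2"
    unfolding two_point_def using m g \<tau>
    by (subst integral_distr) auto
qed

text \<open>In the randomised case the weights cancel the two score values, leaving
  \<open>(F p2 - F p1) * \<bar>S p1\<bar> * \<bar>S p2\<bar> / (\<bar>S p1\<bar> + \<bar>S p2\<bar>)\<close> with \<open>F\<close> the distribution function of the
  outcome.\<close>

lemma ocqe_step_bound:
  assumes step: "ocqe_step a b t S D" and t: "1 \<le> t" and q: "0 \<le> q" "q \<le> 1" and L: "0 \<le> L"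
    and E: "prob_space E" "sets E = sets (outcome_space a b)" "lipschitz_distribution L E"
    and S: "S \<in> borel_measurable (forecast_space a b)"
  shows "integrable D S"
    and "(\<integral>u. (\<P>(v in E. v \<le> u) - q) * S u \<partial>D) \<le> L / (10 * (real t)\<^sup>2)"
proof -
  interpret E: prob_space E by fact
  have space_E: "space E = {a<..b}"
    using sets_eq_imp_space_eq[OF E(2)] by (simp add: space_restrict_space)
  have ab: "a < b" using E.not_empty space_E by auto
  let ?F = "\<lambda>u. \<P>(v in E. v \<le> u)"
  let ?g = "\<lambda>u. (?F u - q) * S u"
  \<comment> \<open>The outcome interval is open on the left, so there is no mass at the lowest
    forecast.\<close>
  have "{v \<in> space E. v \<le> a} = {}" using space_E by auto
  then have Fa: "?F a = 0" by (simp only: measure_empty)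
  have "{v \<in> space E. v \<le> b} = space E" unfolding space_E by auto
  then have Fb: "?F b = 1" by (rule trans[OF arg_cong[of _ _ E.prob] E.prob_space])
  \<comment> \<open>Monotonicity makes the distribution function, and with it the integrand, Borel
    measurable.\<close>
  have "mono ?F"
  proof (rule monoI)
    fix u w :: real assume "u \<le> w"
    have "(\<lambda>u. u) \<in> borel_measurable E"
      by (auto simp: measurable_cong_sets[OF E(2) refl] intro: measurable_restrict_space1)
    then have "{v \<in> space E. v \<le> w} \<in> sets E" by measurable
    then show "?F u \<le> ?F w" using \<open>u \<le> w\<close> by (intro E.finite_measure_mono) auto
  qed
  then have "?F \<in> borel_measurable borel" by (rule borel_measurable_mono)
  then have g: "?g \<in> borel_measurable (forecast_space a b)"
    using S by (intro borel_measurable_times[OF borel_measurable_diff[OF measurable_restrict_space1]]) auto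
  have C: "0 \<le> L / (10 * (real t)\<^sup>2)" using L by simp
  consider (low) "S a \<ge> 0" "D = return (forecast_space a b) a"
    | (high) "S b \<le> 0" "D = return (forecast_space a b) b"
    | (mid) p1 p2 where "p1 \<in> {a..b}" "p2 \<in> {a..b}" "S p1 < 0" "0 < S p2"
        "\<bar>p1 - p2\<bar> \<le> 1 / (10 * (real t)\<^sup>2 * \<bar>S p1\<bar>)"
        "D = two_point a b (\<bar>S p2\<bar> / (\<bar>S p1\<bar> + \<bar>S p2\<bar>)) p1 p2"
    using step unfolding ocqe_step_def by (auto split: if_splits)
  then have "integrable D S \<and> (\<integral>u. ?g u \<partial>D) \<le> L / (10 * (real t)\<^sup>2)"
  proof cases
    case low
    have "(\<integral>u. ?g u \<partial>D) = ?g a"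
      unfolding low using ab g by (intro integral_return) (auto simp: space_restrict_space)
    \<comment> \<open>The integrand is \<open>- q * S a\<close>, of the right sign because the score
      at the lowest forecast is nonnegative.\<close>
    also have "\<dots> \<le> 0" using Fa low q by simp
    finally show ?thesis using low S ab C by (auto intro!: integrable_return simp: space_restrict_space)
  next
    case high
    have "(\<integral>u. ?g u \<partial>D) = ?g b"
      unfolding high using ab g by (intro integral_return) (auto simp: space_restrict_space)
    \<comment> \<open>The integrand is \<open>(1 - q) * S b\<close> with a nonpositive
      score.\<close>
    also have "\<dots> \<le> 0" using Fb high q by (simp add: mult_nonneg_nonpos)
    finally show ?thesis using high S ab C by (auto intro!: integrable_return simp: space_restrict_space)
  next
    case mid
    define A B where "A = \<bar>S p1\<bar>" and "B = \<bar>S p2\<bar>"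
    have AB: "A > 0" "B > 0" "S p1 = - A" "S p2 = B" using mid by (auto simp: A_def B_def)
    define \<tau> where "\<tau> = B / (A + B)"
    have \<tau>: "0 \<le> \<tau>" "\<tau> \<le> 1" "1 - \<tau> = A / (A + B)" using AB by (auto simp: \<tau>_def field_simps)
    have D: "D = two_point a b \<tau> p1 p2" using mid by (simp add: \<tau>_def A_def B_def)
    have "(\<integral>u. ?g u \<partial>D) = \<tau> * ?g p1 + (1 - \<tau>) * ?g p2"
      unfolding D using mid \<tau> g by (intro two_point_integral) auto
    also have "\<dots> = (A * \<tau>) * (?F p2 - ?F p1)"
    proof -
      \<comment> \<open>Both sides are \<open>A * B / (A + B)\<close>. This balance eliminates
        \<open>q\<close> and leaves only the increment of the distribution function.\<close>
      have "(1 - \<tau>) * B = A * \<tau>" unfolding \<tau>(3) by (simp add: \<tau>_def)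
      then have "(1 - \<tau>) * (c * B) = (A * \<tau>) * c" for c
        by (simp only: mult.left_commute[of _ c] mult.commute[of _ c])
      then show ?thesis unfolding AB(3,4) by (simp only:) (simp add: algebra_simps)
    qed
    also have "\<dots> \<le> (A * \<tau>) * (L * \<bar>p1 - p2\<bar>)"
      using E(3) AB \<tau> unfolding lipschitz_distribution_def
      by (intro mult_left_mono) (auto simp: abs_le_iff abs_minus_commute dest: spec[of _ p2])
    \<comment> \<open>Here \<open>\<tau>\<close> is bounded by 1, and the required closeness of the
      two points has \<open>A\<close> in its denominator, which cancels the remaining
      factor.\<close>
    also have "\<dots> \<le> (A * 1) * (L * (1 / (10 * (real t)\<^sup>2 * A)))"
      using mid AB \<tau> L by (intro mult_mono) (auto simp: A_def[symmetric])
    also have "\<dots> = L / (10 * (real t)\<^sup>2)" using AB by simp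
    finally show ?thesis
      unfolding D using mid \<tau> S by (auto intro!: two_point_integral)
  qed
  then show "integrable D S" "(\<integral>u. ?g u \<partial>D) \<le> L / (10 * (real t)\<^sup>2)" by auto
qed

section \<open>Two elementary sums\<close>

lemma sum_square_symmetric:
  fixes a :: "nat \<Rightarrow> nat \<Rightarrow> real"
  assumes "\<And>i j. i \<in> {1..n} \<Longrightarrow> j \<in> {1..n} \<Longrightarrow> a i j = a j i"
  shows "(\<Sum>i=1..n. \<Sum>j=1..n. a i j) = (\<Sum>i=1..n. a i i) + 2 * (\<Sum>t=1..n. \<Sum>i\<in>{1..<t}. a t i)"
  using assms
proof (induction n)
  case (Suc n)
  have "(\<Sum>i=1..n. a i (Suc n)) = (\<Sum>i=1..n. a (Suc n) i)"
    by (rule sum.cong[OF refl], rule Suc.prems) auto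
  moreover have "{1..<Suc n} = {1..n}" by auto
  ultimately show ?case using Suc.IH Suc.prems by (simp add: sum.distrib)
qed simp

lemma sum_inverse_squares_le: "(\<Sum>t=1..n. 1 / (real t)\<^sup>2) \<le> 2"
proof -
  \<comment> \<open>The sharper bound is the one that the induction carries: the new term is at most
    the telescoping difference \<open>1 / real n - 1 / real (Suc n)\<close>.\<close>
  have "(\<Sum>t=1..n. 1 / (real t)\<^sup>2) \<le> 2 - 1 / real n" if "n \<ge> 1" for n
    using that
  proof (induction n rule: dec_induct)
    case (step n)
    have "1 / (real (Suc n))\<^sup>2 \<le> 1 / real n - 1 / real (Suc n)"
    proof -
      have "1 / (real (Suc n))\<^sup>2 \<le> 1 / (real n * real (Suc n))"
        using step(1) by (intro divide_left_mono) (auto simp: power2_eq_square)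
      also have "\<dots> = 1 / real n - 1 / real (Suc n)"
        using step(1) by (simp add: field_simps)
      finally show ?thesis .
    qed
    then show ?case using step by simp
  qed simp
  from this[of n] show ?thesis by (cases "n = 0") (auto intro: order_trans)
qed

section \<open>Linear functionals of a finite-dimensional feature map\<close>

lemma (in rkhs) feature_functional:
  fixes \<Phi> :: "'z \<Rightarrow> 'e::euclidean_space"
  assumes k: "\<And>z w. z \<in> Z \<Longrightarrow> w \<in> Z \<Longrightarrow> k z w = \<Phi> z \<bullet> \<Phi> w"
  obtains f where "f \<in> H" "\<And>z. z \<in> Z \<Longrightarrow> f z = v \<bullet> \<Phi> z" "rkhs_norm ip f \<le> norm v"
proof -
  obtain u u' where u: "u \<in> span (\<Phi> ` Z)" and u': "\<And>w. w \<in> span (\<Phi> ` Z) \<Longrightarrow> orthogonal u' w"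
    and v: "v = u + u'"
    using orthogonal_subspace_decomp_exists by metis
  obtain I r where I: "finite I" "I \<subseteq> \<Phi> ` Z" and ur: "u = (\<Sum>a\<in>I. r a *\<^sub>R a)"
    using u unfolding span_explicit by auto
  \<comment> \<open>Chosen preimages turn the feature vectors in the expansion of \<open>u\<close>
    into points, whose sections can be combined with the same coefficients.\<close>
  obtain \<zeta> where \<zeta>: "\<And>a. a \<in> I \<Longrightarrow> \<zeta> a \<in> Z" "\<And>a. a \<in> I \<Longrightarrow> \<Phi> (\<zeta> a) = a"
    using I(2) by (metis image_iff subset_iff)
  define f where "f = (\<lambda>w. \<Sum>a\<in>I. r a * kernel_section (\<zeta> a) w)"
  have "f \<in> H" unfolding f_def using I(1) \<zeta>(1) by (rule ip_kernel_lincomb)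
  moreover have "f z = v \<bullet> \<Phi> z" if z: "z \<in> Z" for z
  proof -
    have "f z = (\<Sum>a\<in>I. r a * (a \<bullet> \<Phi> z))"
      unfolding f_def using \<zeta> z by (intro sum.cong) (auto simp: kernel_section_def k)
    also have "\<dots> = u \<bullet> \<Phi> z" by (simp add: ur inner_sum_left)
    also have "\<dots> = v \<bullet> \<Phi> z"
      using u'[OF span_base, of "\<Phi> z"] z by (simp add: v inner_add_left orthogonal_def)
    finally show ?thesis .
  qed
  moreover have "rkhs_norm ip f \<le> norm v"
  proof -
    have "ip f f = (\<Sum>a\<in>I. \<Sum>b\<in>I. r a * r b * k (\<zeta> a) (\<zeta> b))"
      unfolding f_def using I(1) \<zeta>(1) by (rule ip_kernel_lincomb)
    also have "\<dots> = (\<Sum>a\<in>I. \<Sum>b\<in>I. r a * r b * (a \<bullet> b))"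
      using \<zeta> by (intro sum.cong) (auto simp: k)
    also have "\<dots> = u \<bullet> u"
      by (simp add: ur inner_sum_left inner_sum_right sum_distrib_left mult.assoc) (simp add: inner_commute)
    \<comment> \<open>Pythagoras for the orthogonal parts \<open>u\<close> and
      \<open>u'\<close>.\<close>
    also have "\<dots> \<le> v \<bullet> v"
      using u'[OF u] by (simp add: v inner_add_left inner_add_right orthogonal_def inner_commute)
    finally show ?thesis by (simp add: rkhs_norm_def norm_eq_sqrt_inner)
  qed
  ultimately show thesis using that by blast
qed

section \<open>The interaction under the algorithm: measurability and the bound for one
  round\<close>

locale ocqe_interaction =
  online_quantile_protocol M G F X Ymin Ymax T x Dp Dy p y +
  rkhs "space X \<times> {Ymin..Ymax}" H ip k
  for M :: "'w measure"
    and G F :: "nat \<Rightarrow> 'w measure"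
    and X :: "'x measure"
    and Ymin Ymax :: real
    and T :: nat
    and x :: "nat \<Rightarrow> 'w \<Rightarrow> 'x"
    and Dp Dy :: "nat \<Rightarrow> 'w \<Rightarrow> real measure"
    and p y :: "nat \<Rightarrow> 'w \<Rightarrow> real"
    and H :: "('x \<times> real \<Rightarrow> real) set"
    and ip :: "('x \<times> real \<Rightarrow> real) \<Rightarrow> ('x \<times> real \<Rightarrow> real) \<Rightarrow> real"
    and k :: "'x \<times> real \<Rightarrow> 'x \<times> real \<Rightarrow> real" +
  fixes q L :: real
  assumes q: "0 \<le> q" "q \<le> 1"
    and L: "0 \<le> L"
    and k_measurable:
      "(\<lambda>(z, z'). k z z') \<in> borel_measurable
         ((X \<Otimes>\<^sub>M forecast_space Ymin Ymax) \<Otimes>\<^sub>M (X \<Otimes>\<^sub>M forecast_space Ymin Ymax))"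
    and algorithm:
      "\<And>t \<omega>. t \<in> {1..T} \<Longrightarrow> \<omega> \<in> space M \<Longrightarrow>
         ocqe_step Ymin Ymax t (ocqe_score k q (\<lambda>i. x i \<omega>) (\<lambda>i. p i \<omega>) (\<lambda>i. y i \<omega>) t) (Dp t \<omega>)"
    and lipschitz:
      "\<And>t \<omega>. t \<in> {1..T} \<Longrightarrow> \<omega> \<in> space M \<Longrightarrow> lipschitz_distribution L (Dy t \<omega>)"
begin

abbreviation "point_space \<equiv> X \<Otimes>\<^sub>M forecast_space Ymin Ymax"

abbreviation point :: "nat \<Rightarrow> 'w \<Rightarrow> 'x \<times> real" where
  "point t \<omega> \<equiv> (x t \<omega>, p t \<omega>)"

abbreviation err :: "nat \<Rightarrow> 'w \<Rightarrow> real" where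
  "err t \<omega> \<equiv> of_bool (y t \<omega> \<le> p t \<omega>) - q"

abbreviation score :: "nat \<Rightarrow> 'w \<Rightarrow> real \<Rightarrow> real" where
  "score t \<omega> \<equiv> ocqe_score k q (\<lambda>i. x i \<omega>) (\<lambda>i. p i \<omega>) (\<lambda>i. y i \<omega>) t"

lemma space_point_space: "space point_space = space X \<times> {Ymin..Ymax}"
  by (simp add: space_pair_measure space_restrict_space)

lemma G_le_F_later: "i \<le> t \<Longrightarrow> t \<in> {1..T} \<Longrightarrow> subalgebra (F t) (G i)"
  using G_le_F[of t] sets_F_mono[of i t] subalgebra_F[of t] space_F[of i]
  by (auto simp: subalgebra_def)

text \<open>Everything about round \<open>i\<close> is known in \<open>G (Suc i)\<close>, hence in
  \<open>F t\<close> for every later \<open>t\<close>. This is what makes the score of round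
  \<open>t\<close> a fixed function when the draws of that round are made.\<close>

lemma
  assumes i: "i \<in> {1..T}"
  shows point_measurable_M: "point i \<in> M \<rightarrow>\<^sub>M point_space"
    and err_measurable_M: "err i \<in> borel_measurable M"
    and point_measurable_F: "i < t \<Longrightarrow> t \<in> {1..T} \<Longrightarrow> point i \<in> F t \<rightarrow>\<^sub>M point_space"
    and err_measurable_F: "i < t \<Longrightarrow> t \<in> {1..T} \<Longrightarrow> err i \<in> borel_measurable (F t)"
proof -
  have "subalgebra (G (Suc i)) (G i)"
    using sets_F_mono[of i "Suc i"] space_F by (auto simp: subalgebra_def)
  then have x: "x i \<in> G (Suc i) \<rightarrow>\<^sub>M X"
    using measurable_from_subalg context_choice[OF i] by blast
  have point: "point i \<in> G (Suc i) \<rightarrow>\<^sub>M point_space"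
    using x forecast_revealed[OF i] by measurable
  have [measurable]: "p i \<in> borel_measurable (G (Suc i))" "y i \<in> borel_measurable (G (Suc i))"
    using forecast_revealed[OF i] outcome_revealed[OF i] by (simp_all add: measurable_restrict_space2_iff)
  have err: "err i \<in> borel_measurable (G (Suc i))" by measurable
  show "point i \<in> M \<rightarrow>\<^sub>M point_space" "err i \<in> borel_measurable M"
    using point err measurable_from_subalg[OF subalgebra_G] by blast+
  show "point i \<in> F t \<rightarrow>\<^sub>M point_space" "err i \<in> borel_measurable (F t)" if "i < t" "t \<in> {1..T}"
    using measurable_from_subalg[OF G_le_F_later[of "Suc i" t] point]
      measurable_from_subalg[OF G_le_F_later[of "Suc i" t] err] that by simp_all
qed

lemma point_mem: "t \<in> {1..T} \<Longrightarrow> \<omega> \<in> space M \<Longrightarrow> point t \<omega> \<in> space X \<times> {Ymin..Ymax}"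
  using measurable_space[OF point_measurable_M] by (simp only: space_point_space)

lemma abs_err_le: "\<bar>err t \<omega>\<bar> \<le> 1"
  using q by auto

lemma kernel_points_measurable:
  "s \<in> {1..T} \<Longrightarrow> t \<in> {1..T} \<Longrightarrow> (\<lambda>\<omega>. k (point s \<omega>) (point t \<omega>)) \<in> borel_measurable M"
  using measurable_compose[OF measurable_Pair[OF point_measurable_M point_measurable_M] k_measurable]
  by simp

lemma mem_measurable: "f \<in> H \<Longrightarrow> f \<in> borel_measurable point_space"
proof (rule mem_borel_measurable[OF space_point_space])
  fix z assume "z \<in> space X \<times> {Ymin..Ymax}"
  then have "z \<in> space point_space" by (simp only: space_point_space)
  from measurable_compose[OF measurable_Pair1'[OF this] k_measurable]
  show "k z \<in> borel_measurable point_space" by simp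
qed

text \<open>Measurability is joint in the past and the forecast argument \<open>u\<close>, since
  \<open>u\<close> is later filled in by the random draw.\<close>

lemma score_measurable:
  assumes t: "t \<in> {1..T}"
  shows "(\<lambda>(\<omega>, u). score t \<omega> u) \<in> borel_measurable (F t \<Otimes>\<^sub>M forecast_space Ymin Ymax)"
proof -
  have x: "x t \<in> F t \<rightarrow>\<^sub>M X"
    using measurable_from_subalg[OF G_le_F_later[OF order_refl t] context_choice[OF t]] .
  have "(\<lambda>z. k (x t (fst z), snd z) (point i (fst z)) * err i (fst z))
      \<in> borel_measurable (F t \<Otimes>\<^sub>M forecast_space Ymin Ymax)" if i: "i \<in> {1..<t}" for i
  proof -
    have i': "i \<in> {1..T}" "i < t" using i t by auto
    note [measurable] = point_measurable_F[OF i' t] err_measurable_F[OF i' t] x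
    have "(\<lambda>z. ((x t (fst z), snd z), point i (fst z))) \<in> F t \<Otimes>\<^sub>M forecast_space Ymin Ymax \<rightarrow>\<^sub>M point_space \<Otimes>\<^sub>M point_space"
      using measurable_compose[OF measurable_fst point_measurable_F[OF i' t]] by measurable
    from measurable_compose[OF this k_measurable]
    have 1: "(\<lambda>z. k (x t (fst z), snd z) (point i (fst z)))
      \<in> borel_measurable (F t \<Otimes>\<^sub>M forecast_space Ymin Ymax)" by simp
    have 2: "(\<lambda>z. err i (fst z)) \<in> borel_measurable (F t \<Otimes>\<^sub>M forecast_space Ymin Ymax)"
      using measurable_compose[OF measurable_fst err_measurable_F[OF i' t]] .
    show ?thesis using 1 2 by (rule borel_measurable_times)
  qed
  then show ?thesis
    unfolding ocqe_score_def split_beta' by (rule borel_measurable_sum)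
qed

text \<open>\<open>ocqe_step_bound\<close> holds for each fixed past, and
  \<open>nn_integral_draw\<close> averages it over the past. As the latter concerns nonnegative
  functions, positive and negative parts stay on opposite sides of the inequality until
  \<open>int\<close> allows their recombination.\<close>

lemma expected_score_bound:
  assumes t: "t \<in> {1..T}"
    and int: "integrable M (\<lambda>\<omega>. err t \<omega> * score t \<omega> (p t \<omega>))"
  shows "(\<integral>\<omega>. err t \<omega> * score t \<omega> (p t \<omega>) \<partial>M) \<le> L / (10 * (real t)\<^sup>2)"
proof -
  have C: "0 \<le> L / (10 * (real t)\<^sup>2)" using L by simp
  define h where "h = (\<lambda>(\<omega>, u, v). (of_bool (v \<le> u) - q) * score t \<omega> u)"
  have h: "h \<in> borel_measurable (F t \<Otimes>\<^sub>M draw_space)"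
  proof -
    have "(\<lambda>z. (fst z, fst (snd z))) \<in> F t \<Otimes>\<^sub>M draw_space \<rightarrow>\<^sub>M F t \<Otimes>\<^sub>M forecast_space Ymin Ymax" by measurable
    from measurable_compose[OF this score_measurable[OF t]]
    have 1: "(\<lambda>z. score t (fst z) (fst (snd z))) \<in> borel_measurable (F t \<Otimes>\<^sub>M draw_space)" by simp
    have "(\<lambda>z. fst (snd z)) \<in> F t \<Otimes>\<^sub>M draw_space \<rightarrow>\<^sub>M forecast_space Ymin Ymax"
      "(\<lambda>z. snd (snd z)) \<in> F t \<Otimes>\<^sub>M draw_space \<rightarrow>\<^sub>M outcome_space Ymin Ymax"
      by measurable
    then have [measurable]: "(\<lambda>z. fst (snd z)) \<in> borel_measurable (F t \<Otimes>\<^sub>M draw_space)"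
      "(\<lambda>z. snd (snd z)) \<in> borel_measurable (F t \<Otimes>\<^sub>M draw_space)"
      by (simp_all add: measurable_restrict_space2_iff)
    have 2: "(\<lambda>z. of_bool (snd (snd z) \<le> fst (snd z)) - q) \<in> borel_measurable (F t \<Otimes>\<^sub>M draw_space)"
      by measurable
    show ?thesis using borel_measurable_times[OF 2 1] by (simp add: h_def split_beta')
  qed
  \<comment> \<open>For fixed \<open>\<omega>\<close> the loss is integrable under the product of
    the two distributions, so the signed bound can be split into its parts.\<close>
  have pointwise: "(\<integral>\<^sup>+z. ennreal (h (\<omega>, z)) \<partial>(Dp t \<omega> \<Otimes>\<^sub>M Dy t \<omega>))
      \<le> ennreal (L / (10 * (real t)\<^sup>2)) + (\<integral>\<^sup>+z. ennreal (- h (\<omega>, z)) \<partial>(Dp t \<omega> \<Otimes>\<^sub>M Dy t \<omega>))"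
    if \<omega>: "\<omega> \<in> space M" for \<omega>
  proof -
    have \<omega>': "\<omega> \<in> space (F t)" "\<omega> \<in> space (G t)"
      using \<omega> subalgebra_F[OF t] subalgebra_G[of t] by (auto simp: subalgebra_def)
    have D: "prob_space (Dp t \<omega>)" "sets (Dp t \<omega>) = sets (forecast_space Ymin Ymax)"
      "prob_space (Dy t \<omega>)" "sets (Dy t \<omega>) = sets (outcome_space Ymin Ymax)"
      using measurable_space[OF forecaster_choice[OF t] \<omega>'(2)] measurable_space[OF nature_choice[OF t] \<omega>'(1)]
      by (auto simp: space_prob_algebra)
    have S: "score t \<omega> \<in> borel_measurable (forecast_space Ymin Ymax)"
      using measurable_compose[OF measurable_Pair1'[OF \<omega>'(1)] score_measurable[OF t]] by simp
    have "1 \<le> t" using t by simp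
    note step = ocqe_step_bound[OF algorithm[OF t \<omega>] this q L D(3,4) lipschitz[OF t \<omega>] S]
    note loss = pair_integral_quantile_loss[OF D(1,3,2,4) q step(1)]
    show ?thesis
      using integral_le_iff_nn_integral_le[OF loss(1) C] loss(2) step(2)
      by (simp add: h_def)
  qed
  have "(\<integral>\<^sup>+\<omega>. ennreal (h (\<omega>, p t \<omega>, y t \<omega>)) \<partial>M)
      = (\<integral>\<^sup>+\<omega>. \<integral>\<^sup>+z. ennreal (h (\<omega>, z)) \<partial>(Dp t \<omega> \<Otimes>\<^sub>M Dy t \<omega>) \<partial>M)"
    using nn_integral_draw[OF t, of "\<lambda>z. ennreal (h z)"] h by simp
  also have "\<dots> \<le> (\<integral>\<^sup>+\<omega>. ennreal (L / (10 * (real t)\<^sup>2))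
      + (\<integral>\<^sup>+z. ennreal (- h (\<omega>, z)) \<partial>(Dp t \<omega> \<Otimes>\<^sub>M Dy t \<omega>)) \<partial>M)"
    by (rule nn_integral_mono) (rule pointwise)
  also have "\<dots> \<le> ennreal (L / (10 * (real t)\<^sup>2))
      + (\<integral>\<^sup>+\<omega>. \<integral>\<^sup>+z. ennreal (- h (\<omega>, z)) \<partial>(Dp t \<omega> \<Otimes>\<^sub>M Dy t \<omega>) \<partial>M)"
    using nn_integral_draw_measurable[OF t, of "\<lambda>z. ennreal (- h z)"] h
    by (subst nn_integral_add) (auto simp: emeasure_space_1)
  also have "(\<integral>\<^sup>+\<omega>. \<integral>\<^sup>+z. ennreal (- h (\<omega>, z)) \<partial>(Dp t \<omega> \<Otimes>\<^sub>M Dy t \<omega>) \<partial>M)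
      = (\<integral>\<^sup>+\<omega>. ennreal (- h (\<omega>, p t \<omega>, y t \<omega>)) \<partial>M)"
    using nn_integral_draw[OF t, of "\<lambda>z. ennreal (- h z)"] h by simp
  finally have "(\<integral>\<^sup>+\<omega>. ennreal (err t \<omega> * score t \<omega> (p t \<omega>)) \<partial>M) \<le> ennreal (L / (10 * (real t)\<^sup>2))
      + (\<integral>\<^sup>+\<omega>. ennreal (- (err t \<omega> * score t \<omega> (p t \<omega>))) \<partial>M)"
    by (simp add: h_def)
  then show ?thesis using integral_le_iff_nn_integral_le[OF int C] by simp
qed

section \<open>Integrability and the expected quadratic form\<close>

lemma integrable_test_function:
  assumes f: "f \<in> H" and t: "t \<in> {1..T}"
    and K: "integrable M (\<lambda>\<omega>. k (point t \<omega>) (point t \<omega>))"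
  shows "integrable M (\<lambda>\<omega>. f (point t \<omega>) * err t \<omega>)"
proof (rule Bochner_Integration.integrable_bound)
  show "integrable M (\<lambda>\<omega>. (ip f f + k (point t \<omega>) (point t \<omega>)) / 2)"
    using K by simp
  show "(\<lambda>\<omega>. f (point t \<omega>) * err t \<omega>) \<in> borel_measurable M"
    using measurable_compose[OF point_measurable_M[OF t] mem_measurable[OF f]] err_measurable_M[OF t]
    by (rule borel_measurable_times)
  show "AE \<omega> in M. norm (f (point t \<omega>) * err t \<omega>) \<le> norm ((ip f f + k (point t \<omega>) (point t \<omega>)) / 2)"
  proof (rule AE_I2)
    fix \<omega> assume \<omega>: "\<omega> \<in> space M"
    have nonneg: "0 \<le> ip f f" "0 \<le> k (point t \<omega>) (point t \<omega>)"
      using ip_nonneg[OF f] kernel_nonneg[OF point_mem[OF t \<omega>]] by auto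
    have "(f (point t \<omega>))\<^sup>2 \<le> ip f f * k (point t \<omega>) (point t \<omega>)"
      using point_evaluation_bound[OF f point_mem[OF t \<omega>]] .
    \<comment> \<open>Arithmetic and geometric means: the bound becomes linear in the kernel
      diagonal, which is integrable.\<close>
    also have "\<dots> \<le> ((ip f f + k (point t \<omega>) (point t \<omega>)) / 2)\<^sup>2"
      using zero_le_power2[of "ip f f - k (point t \<omega>) (point t \<omega>)"]
      by (simp add: power2_eq_square field_simps)
    finally have "\<bar>f (point t \<omega>)\<bar> \<le> (ip f f + k (point t \<omega>) (point t \<omega>)) / 2"
      using nonneg abs_le_square_iff[of "f (point t \<omega>)" "(ip f f + k (point t \<omega>) (point t \<omega>)) / 2"] by simp
    moreover have "\<bar>f (point t \<omega>)\<bar> * \<bar>err t \<omega>\<bar> \<le> \<bar>f (point t \<omega>)\<bar> * 1"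
      by (rule mult_left_mono[OF abs_err_le]) simp
    ultimately show "norm (f (point t \<omega>) * err t \<omega>) \<le> norm ((ip f f + k (point t \<omega>) (point t \<omega>)) / 2)"
      unfolding real_norm_def abs_mult using nonneg by linarith
  qed
qed

lemma integrable_cross_term:
  assumes s: "s \<in> {1..T}" and t: "t \<in> {1..T}"
    and K: "\<And>t. t \<in> {1..T} \<Longrightarrow> integrable M (\<lambda>\<omega>. k (point t \<omega>) (point t \<omega>))"
  shows "integrable M (\<lambda>\<omega>. err s \<omega> * err t \<omega> * k (point s \<omega>) (point t \<omega>))"
proof (rule Bochner_Integration.integrable_bound)
  show "integrable M (\<lambda>\<omega>. (k (point s \<omega>) (point s \<omega>) + k (point t \<omega>) (point t \<omega>)) / 2)"
    using K[OF s] K[OF t] by simp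
  show "(\<lambda>\<omega>. err s \<omega> * err t \<omega> * k (point s \<omega>) (point t \<omega>)) \<in> borel_measurable M"
    using err_measurable_M[OF s] err_measurable_M[OF t] kernel_points_measurable[OF s t]
    by (intro borel_measurable_times)
  show "AE \<omega> in M. norm (err s \<omega> * err t \<omega> * k (point s \<omega>) (point t \<omega>))
      \<le> norm ((k (point s \<omega>) (point s \<omega>) + k (point t \<omega>) (point t \<omega>)) / 2)"
  proof (rule AE_I2)
    fix \<omega> assume \<omega>: "\<omega> \<in> space M"
    have "\<bar>err s \<omega>\<bar> * \<bar>err t \<omega>\<bar> \<le> 1"
      using mult_mono[OF abs_err_le abs_err_le] by simp
    then have "\<bar>err s \<omega>\<bar> * \<bar>err t \<omega>\<bar> * \<bar>k (point s \<omega>) (point t \<omega>)\<bar> \<le> 1 * \<bar>k (point s \<omega>) (point t \<omega>)\<bar>"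
      by (rule mult_right_mono) simp
    also have "\<dots> \<le> (k (point s \<omega>) (point s \<omega>) + k (point t \<omega>) (point t \<omega>)) / 2"
      using abs_kernel_le[OF point_mem[OF s \<omega>] point_mem[OF t \<omega>]] by simp
    finally show "norm (err s \<omega> * err t \<omega> * k (point s \<omega>) (point t \<omega>))
      \<le> norm ((k (point s \<omega>) (point s \<omega>) + k (point t \<omega>) (point t \<omega>)) / 2)"
      unfolding real_norm_def abs_mult by linarith
  qed
qed

lemma expected_quadratic_form_bound:
  assumes K: "\<And>t. t \<in> {1..T} \<Longrightarrow> integrable M (\<lambda>\<omega>. k (point t \<omega>) (point t \<omega>))"
  shows "(\<integral>\<omega>. (\<Sum>s=1..T. \<Sum>t=1..T. err s \<omega> * err t \<omega> * k (point s \<omega>) (point t \<omega>)) \<partial>M)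
    \<le> L + (\<Sum>t=1..T. \<integral>\<omega>. k (point t \<omega>) (point t \<omega>) \<partial>M)"
proof -
  define c where "c s t \<omega> = err s \<omega> * err t \<omega> * k (point s \<omega>) (point t \<omega>)" for s t \<omega>
  have c: "integrable M (c s t)" if "s \<in> {1..T}" "t \<in> {1..T}" for s t
    unfolding c_def by (rule integrable_cross_term[OF that K])
  \<comment> \<open>The part of row \<open>t\<close> below the diagonal involves earlier rounds
    only, and is the score at the forecast actually played.\<close>
  have c_score: "(\<Sum>i\<in>{1..<t}. c t i \<omega>) = err t \<omega> * score t \<omega> (p t \<omega>)" for t \<omega>
    by (simp add: c_def ocqe_score_def sum_distrib_left mult_ac)
  have int_score: "integrable M (\<lambda>\<omega>. err t \<omega> * score t \<omega> (p t \<omega>))" if t: "t \<in> {1..T}" for t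
  proof -
    have "integrable M (\<lambda>\<omega>. \<Sum>i\<in>{1..<t}. c t i \<omega>)"
      using t by (intro Bochner_Integration.integrable_sum c) auto
    then show ?thesis by (simp only: c_score)
  qed
  have "(\<integral>\<omega>. (\<Sum>s=1..T. \<Sum>t=1..T. c s t \<omega>) \<partial>M)
      = (\<integral>\<omega>. (\<Sum>t=1..T. c t t \<omega>) + 2 * (\<Sum>t=1..T. err t \<omega> * score t \<omega> (p t \<omega>)) \<partial>M)"
  proof (rule Bochner_Integration.integral_cong[OF refl])
    fix \<omega> assume \<omega>: "\<omega> \<in> space M"
    have "c s t \<omega> = c t s \<omega>" if "s \<in> {1..T}" "t \<in> {1..T}" for s t
      using kernel_commute[OF point_mem point_mem] that \<omega> by (simp add: c_def)
    from sum_square_symmetric[of T "\<lambda>s t. c s t \<omega>", OF this]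
    show "(\<Sum>s=1..T. \<Sum>t=1..T. c s t \<omega>)
      = (\<Sum>t=1..T. c t t \<omega>) + 2 * (\<Sum>t=1..T. err t \<omega> * score t \<omega> (p t \<omega>))"
      by (simp only: c_score)
  qed
  also have "\<dots> = (\<Sum>t=1..T. \<integral>\<omega>. c t t \<omega> \<partial>M) + 2 * (\<Sum>t=1..T. \<integral>\<omega>. err t \<omega> * score t \<omega> (p t \<omega>) \<partial>M)"
    using c int_score
    by (subst Bochner_Integration.integral_add)
      (auto intro!: Bochner_Integration.integrable_sum integrable_mult_right simp: Bochner_Integration.integral_sum)
  also have "\<dots> \<le> (\<Sum>t=1..T. \<integral>\<omega>. k (point t \<omega>) (point t \<omega>) \<partial>M) + L"
  proof (rule add_mono)
    show "(\<Sum>t=1..T. \<integral>\<omega>. c t t \<omega> \<partial>M) \<le> (\<Sum>t=1..T. \<integral>\<omega>. k (point t \<omega>) (point t \<omega>) \<partial>M)"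
    proof (intro sum_mono integral_mono c K)
      fix t \<omega> assume t: "t \<in> {1..T}" and \<omega>: "\<omega> \<in> space M"
      have "err t \<omega> * err t \<omega> \<le> 1"
        using mult_mono[OF abs_err_le abs_err_le, of t \<omega> t \<omega>] by (simp flip: abs_mult)
      then show "c t t \<omega> \<le> k (point t \<omega>) (point t \<omega>)"
        using mult_right_mono[OF _ kernel_nonneg[OF point_mem[OF t \<omega>]]] by (fastforce simp: c_def)
    qed
    have "(\<Sum>t=1..T. \<integral>\<omega>. err t \<omega> * score t \<omega> (p t \<omega>) \<partial>M) \<le> (\<Sum>t=1..T. L / (10 * (real t)\<^sup>2))"
      by (intro sum_mono expected_score_bound int_score)
    also have "\<dots> = L / 10 * (\<Sum>t=1..T. 1 / (real t)\<^sup>2)"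
      by (simp add: sum_distrib_left)
    \<comment> \<open>The total is at most \<open>L / 5\<close>; doubled, it still stays below
      \<open>L\<close>.\<close>
    also have "\<dots> \<le> L / 10 * 2"
      using L by (intro mult_left_mono sum_inverse_squares_le) auto
    finally show "2 * (\<Sum>t=1..T. \<integral>\<omega>. err t \<omega> * score t \<omega> (p t \<omega>) \<partial>M) \<le> L"
      using L by simp
  qed
  finally show ?thesis by (simp add: c_def add.commute)
qed

section \<open>The regret bounds\<close>

lemma regret_bound:
  assumes f: "f \<in> H"
    and K: "\<And>t. t \<in> {1..T} \<Longrightarrow> integrable M (\<lambda>\<omega>. k (point t \<omega>) (point t \<omega>))"
  shows "\<bar>\<Sum>t=1..T. \<integral>\<omega>. f (point t \<omega>) * err t \<omega> \<partial>M\<bar>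
    \<le> rkhs_norm ip f * sqrt (L + (\<Sum>t=1..T. \<integral>\<omega>. k (point t \<omega>) (point t \<omega>) \<partial>M))"
proof -
  let ?N = "\<lambda>\<omega>. \<Sum>t=1..T. f (point t \<omega>) * err t \<omega>"
  let ?Q = "\<lambda>\<omega>. \<Sum>s=1..T. \<Sum>t=1..T. err s \<omega> * err t \<omega> * k (point s \<omega>) (point t \<omega>)"
  have N: "integrable M ?N"
    using integrable_test_function[OF f _ K] by (intro Bochner_Integration.integrable_sum) auto
  have Q: "integrable M ?Q"
    by (intro Bochner_Integration.integrable_sum integrable_cross_term K)
  have NQ: "(?N \<omega>)\<^sup>2 \<le> ip f f * ?Q \<omega>" if "\<omega> \<in> space M" for \<omega>
    using kernel_quadratic_form_bound[OF f, of "{1..T}" "\<lambda>t. point t \<omega>" "\<lambda>t. err t \<omega>"] point_mem that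
    by (simp add: mult.commute)
  \<comment> \<open>Square integrability follows from the pointwise domination by the integrable
    form \<open>Q\<close>.\<close>
  have N2: "integrable M (\<lambda>\<omega>. (?N \<omega>)\<^sup>2)"
  proof (rule Bochner_Integration.integrable_bound)
    show "integrable M (\<lambda>\<omega>. ip f f * ?Q \<omega>)" using Q by simp
    show "(\<lambda>\<omega>. (?N \<omega>)\<^sup>2) \<in> borel_measurable M"
      using borel_measurable_integrable[OF N] by (rule borel_measurable_power)
    show "AE \<omega> in M. norm ((?N \<omega>)\<^sup>2) \<le> norm (ip f f * ?Q \<omega>)"
      using NQ by (intro AE_I2) (fastforce intro: order_trans)
  qed
  \<comment> \<open>Jensen's inequality, as nonnegativity of the variance.\<close>
  have "(\<integral>\<omega>. ?N \<omega> \<partial>M)\<^sup>2 \<le> (\<integral>\<omega>. (?N \<omega>)\<^sup>2 \<partial>M)"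
    using variance_eq[OF N N2] variance_positive[of ?N] by simp
  also have "\<dots> \<le> (\<integral>\<omega>. ip f f * ?Q \<omega> \<partial>M)"
    using N2 Q NQ by (intro integral_mono) auto
  also have "\<dots> \<le> ip f f * (L + (\<Sum>t=1..T. \<integral>\<omega>. k (point t \<omega>) (point t \<omega>) \<partial>M))"
    using expected_quadratic_form_bound[OF K] ip_nonneg[OF f] by (simp add: mult_left_mono)
  finally have "sqrt ((\<integral>\<omega>. ?N \<omega> \<partial>M)\<^sup>2)
      \<le> sqrt (ip f f * (L + (\<Sum>t=1..T. \<integral>\<omega>. k (point t \<omega>) (point t \<omega>) \<partial>M)))"
    by (rule real_sqrt_le_mono)
  moreover have "(\<integral>\<omega>. ?N \<omega> \<partial>M) = (\<Sum>t=1..T. \<integral>\<omega>. f (point t \<omega>) * err t \<omega> \<partial>M)"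
    using integrable_test_function[OF f _ K] by (intro Bochner_Integration.integral_sum) auto
  ultimately show ?thesis by (simp add: rkhs_norm_def real_sqrt_mult)
qed

lemma kernel_integrable_iff:
  assumes t: "t \<in> {1..T}"
  shows "integrable M (\<lambda>\<omega>. k (point t \<omega>) (point t \<omega>))
    \<longleftrightarrow> (\<integral>\<^sup>+\<omega>. ennreal (k (point t \<omega>) (point t \<omega>)) \<partial>M) < \<infinity>"
proof -
  have "(\<integral>\<^sup>+\<omega>. ennreal (norm (k (point t \<omega>) (point t \<omega>))) \<partial>M)
      = (\<integral>\<^sup>+\<omega>. ennreal (k (point t \<omega>) (point t \<omega>)) \<partial>M)"
    using kernel_nonneg[OF point_mem[OF t]] by (intro nn_integral_cong) simp
  then show ?thesis
    using kernel_points_measurable[OF t t] by (simp add: integrable_iff_bounded)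
qed

text \<open>If every diagonal expectation is finite, this is \<open>regret_bound\<close> in extended
  form. Otherwise the root is infinite and the left side, whatever values its integrals take, is an
  \<open>ennreal\<close> image of a real number.\<close>

lemma regret_bound_ennreal:
  assumes f: "f \<in> H"
  shows "ennreal \<bar>\<Sum>t=1..T. \<integral>\<omega>. f (point t \<omega>) * err t \<omega> \<partial>M\<bar>
    \<le> ennreal (rkhs_norm ip f) * ennreal_sqrt (ennreal L +
        (\<Sum>t=1..T. \<integral>\<^sup>+\<omega>. ennreal (k (point t \<omega>) (point t \<omega>)) \<partial>M))"
proof (cases "\<forall>t\<in>{1..T}. integrable M (\<lambda>\<omega>. k (point t \<omega>) (point t \<omega>))")
  case True
  have nonneg: "0 \<le> (\<integral>\<omega>. k (point t \<omega>) (point t \<omega>) \<partial>M)" if "t \<in> {1..T}" for t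
    using kernel_nonneg[OF point_mem[OF that]] by (rule Bochner_Integration.integral_nonneg)
  have "(\<Sum>t=1..T. \<integral>\<^sup>+\<omega>. ennreal (k (point t \<omega>) (point t \<omega>)) \<partial>M)
      = (\<Sum>t=1..T. ennreal (\<integral>\<omega>. k (point t \<omega>) (point t \<omega>) \<partial>M))"
    using True kernel_nonneg[OF point_mem] by (intro sum.cong nn_integral_eq_integral AE_I2) auto
  also have "\<dots> = ennreal (\<Sum>t=1..T. \<integral>\<omega>. k (point t \<omega>) (point t \<omega>) \<partial>M)"
    using nonneg by (rule sum_ennreal)
  finally have "ennreal L + (\<Sum>t=1..T. \<integral>\<^sup>+\<omega>. ennreal (k (point t \<omega>) (point t \<omega>)) \<partial>M)
      = ennreal (L + (\<Sum>t=1..T. \<integral>\<omega>. k (point t \<omega>) (point t \<omega>) \<partial>M))"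
    using ennreal_plus[OF L sum_nonneg[of "{1..T}", OF nonneg]] by simp
  moreover have "0 \<le> L + (\<Sum>t=1..T. \<integral>\<omega>. k (point t \<omega>) (point t \<omega>) \<partial>M)"
    using L nonneg by (intro add_nonneg_nonneg sum_nonneg)
  moreover have "0 \<le> rkhs_norm ip f"
    using ip_nonneg[OF f] by (simp add: rkhs_norm_def)
  ultimately show ?thesis
    using ennreal_leI[OF regret_bound[OF f]] True by (simp add: ennreal_sqrt_def ennreal_mult)
next
  case False
  then obtain t where t: "t \<in> {1..T}" "\<not> integrable M (\<lambda>\<omega>. k (point t \<omega>) (point t \<omega>))" by blast
  then have "(\<integral>\<^sup>+\<omega>. ennreal (k (point t \<omega>) (point t \<omega>)) \<partial>M) = \<infinity>"
    unfolding kernel_integrable_iff[OF t(1)] by (metis infinity_ennreal_def less_top)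
  then have "\<infinity> \<le> (\<Sum>t=1..T. \<integral>\<^sup>+\<omega>. ennreal (k (point t \<omega>) (point t \<omega>)) \<partial>M)"
    using member_le_sum[OF t(1), of "\<lambda>t. \<integral>\<^sup>+\<omega>. ennreal (k (point t \<omega>) (point t \<omega>)) \<partial>M"] by simp
  then have "(\<Sum>t=1..T. \<integral>\<^sup>+\<omega>. ennreal (k (point t \<omega>) (point t \<omega>)) \<partial>M) = \<infinity>"
    by (simp only: infinity_ennreal_def top.extremum_unique)
  then have top: "ennreal_sqrt (ennreal L +
      (\<Sum>t=1..T. \<integral>\<^sup>+\<omega>. ennreal (k (point t \<omega>) (point t \<omega>)) \<partial>M)) = \<infinity>"
    by (simp add: ennreal_sqrt_def)
  \<comment> \<open>As \<open>0 * \<infinity> = 0\<close> in \<open>ennreal\<close>, zero norm is a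
    separate case: definiteness then makes \<open>f\<close>, and so the left side, vanish.\<close>
  show ?thesis
  proof (cases "ip f f = 0")
    case True
    then have "f = (\<lambda>z. 0)" by (rule ip_definite[OF f])
    then show ?thesis by simp
  next
    case False
    then have "0 < rkhs_norm ip f"
      using ip_nonneg[OF f] by (simp add: rkhs_norm_def)
    then show ?thesis unfolding top by (simp add: ennreal_mult_top)
  qed
qed

text \<open>The bound on the features bounds the kernel diagonal by \<open>B\<close>, so all
  integrability holds outright and \<open>regret_bound\<close> applies to the member of
  \<open>H\<close> given by \<open>feature_functional\<close>. That member agrees with the linear
  functional on the points actually visited.\<close>

lemma feature_regret_bound:
  fixes \<Phi> :: "'x \<times> real \<Rightarrow> 'e::euclidean_space"
  assumes k: "\<And>z w. z \<in> space X \<times> {Ymin..Ymax} \<Longrightarrow> w \<in> space X \<times> {Ymin..Ymax} \<Longrightarrow> k z w = \<Phi> z \<bullet> \<Phi> w"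
    and B: "\<And>z. z \<in> space X \<times> {Ymin..Ymax} \<Longrightarrow> (norm (\<Phi> z))\<^sup>2 \<le> B"
  shows "t \<in> {1..T} \<Longrightarrow> integrable M (\<lambda>\<omega>. (v \<bullet> \<Phi> (point t \<omega>)) * err t \<omega>)"
    and "\<bar>\<Sum>t=1..T. \<integral>\<omega>. (v \<bullet> \<Phi> (point t \<omega>)) * err t \<omega> \<partial>M\<bar> \<le> norm v * sqrt (L + B * real T)"
proof -
  obtain f where f: "f \<in> H" and f_eq: "\<And>z. z \<in> space X \<times> {Ymin..Ymax} \<Longrightarrow> f z = v \<bullet> \<Phi> z"
    and f_norm: "rkhs_norm ip f \<le> norm v"
    using feature_functional[OF k] by blast
  have k_le: "k (point t \<omega>) (point t \<omega>) \<le> B" if "t \<in> {1..T}" "\<omega> \<in> space M" for t \<omega>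
    using B[OF point_mem[OF that]] k[OF point_mem[OF that] point_mem[OF that]]
    by (simp add: power2_norm_eq_inner)
  have K: "integrable M (\<lambda>\<omega>. k (point t \<omega>) (point t \<omega>))" if t: "t \<in> {1..T}" for t
    using kernel_points_measurable[OF t t] kernel_nonneg[OF point_mem[OF t]] k_le[OF t]
    by (intro integrable_const_bound[where B = B]) auto
  have eq: "(v \<bullet> \<Phi> (point t \<omega>)) * err t \<omega> = f (point t \<omega>) * err t \<omega>"
    if "t \<in> {1..T}" "\<omega> \<in> space M" for t \<omega>
    using f_eq[OF point_mem[OF that]] by simp
  show "integrable M (\<lambda>\<omega>. (v \<bullet> \<Phi> (point t \<omega>)) * err t \<omega>)" if t: "t \<in> {1..T}"
    using integrable_test_function[OF f t K[OF t]] eq[OF t]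
    by (subst Bochner_Integration.integrable_cong[OF refl]) auto
  have "(\<Sum>t=1..T. \<integral>\<omega>. (v \<bullet> \<Phi> (point t \<omega>)) * err t \<omega> \<partial>M)
      = (\<Sum>t=1..T. \<integral>\<omega>. f (point t \<omega>) * err t \<omega> \<partial>M)"
    by (intro sum.cong Bochner_Integration.integral_cong refl eq)
  then have "\<bar>\<Sum>t=1..T. \<integral>\<omega>. (v \<bullet> \<Phi> (point t \<omega>)) * err t \<omega> \<partial>M\<bar>
      \<le> rkhs_norm ip f * sqrt (L + (\<Sum>t=1..T. \<integral>\<omega>. k (point t \<omega>) (point t \<omega>) \<partial>M))"
    using regret_bound[OF f K] by simp
  also have "\<dots> \<le> norm v * sqrt (L + B * real T)"
  proof (intro mult_mono f_norm real_sqrt_le_mono add_left_mono)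
    have "(\<integral>\<omega>. k (point t \<omega>) (point t \<omega>) \<partial>M) \<le> B" if t: "t \<in> {1..T}" for t
    proof -
      have "(\<integral>\<omega>. k (point t \<omega>) (point t \<omega>) \<partial>M) \<le> (\<integral>\<omega>. B \<partial>M)"
        using K[OF t] k_le[OF t] by (intro integral_mono) auto
      then show ?thesis by (simp add: prob_space)
    qed
    then show "(\<Sum>t=1..T. \<integral>\<omega>. k (point t \<omega>) (point t \<omega>) \<partial>M) \<le> B * real T"
      using sum_mono[of "{1..T}" _ "\<lambda>_. B"] by (simp add: mult.commute)
    show "0 \<le> sqrt (L + (\<Sum>t=1..T. \<integral>\<omega>. k (point t \<omega>) (point t \<omega>) \<partial>M))"
      using L kernel_nonneg[OF point_mem]
      by (intro real_sqrt_ge_zero add_nonneg_nonneg sum_nonneg Bochner_Integration.integral_nonneg) auto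
  qed simp
  finally show "\<bar>\<Sum>t=1..T. \<integral>\<omega>. (v \<bullet> \<Phi> (point t \<omega>)) * err t \<omega> \<partial>M\<bar> \<le> norm v * sqrt (L + B * real T)" .
qed

end

theorem theorem10p2:
  fixes M :: "'w measure"
    and G F :: "nat \<Rightarrow> 'w measure"
    and X :: "'x measure"
    and Ymin Ymax q L :: real
    and T :: nat
    and x :: "nat \<Rightarrow> 'w \<Rightarrow> 'x"
    and Dp Dy :: "nat \<Rightarrow> 'w \<Rightarrow> real measure"
    and p y :: "nat \<Rightarrow> 'w \<Rightarrow> real"
    and H :: "('x \<times> real \<Rightarrow> real) set"
    and ip :: "('x \<times> real \<Rightarrow> real) \<Rightarrow> ('x \<times> real \<Rightarrow> real) \<Rightarrow> real"
    and k :: "'x \<times> real \<Rightarrow> 'x \<times> real \<Rightarrow> real"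
  assumes q: "0 \<le> q" "q \<le> 1"
    and L: "0 \<le> L"
    and rkhs: "rkhs (space X \<times> {Ymin..Ymax}) H ip k"
    and k_measurable:
      "(\<lambda>(z, z'). k z z') \<in> borel_measurable
         ((X \<Otimes>\<^sub>M forecast_space Ymin Ymax) \<Otimes>\<^sub>M (X \<Otimes>\<^sub>M forecast_space Ymin Ymax))"
    and protocol: "online_quantile_protocol M G F X Ymin Ymax T x Dp Dy p y"
    and algorithm:
      "\<And>t \<omega>. t \<in> {1..T} \<Longrightarrow> \<omega> \<in> space M \<Longrightarrow>
         ocqe_step Ymin Ymax t (ocqe_score k q (\<lambda>i. x i \<omega>) (\<lambda>i. p i \<omega>) (\<lambda>i. y i \<omega>) t) (Dp t \<omega>)"
    and lipschitz:
      "\<And>t \<omega>. t \<in> {1..T} \<Longrightarrow> \<omega> \<in> space M \<Longrightarrow> lipschitz_distribution L (Dy t \<omega>)"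
  shows
    "(\<forall>f\<in>H.
        (\<forall>t\<in>{1..T}. (\<integral>\<^sup>+\<omega>. ennreal (k (x t \<omega>, p t \<omega>) (x t \<omega>, p t \<omega>)) \<partial>M) < \<infinity> \<longrightarrow>
           integrable M (\<lambda>\<omega>. f (x t \<omega>, p t \<omega>) * (of_bool (y t \<omega> \<le> p t \<omega>) - q))) \<and>
        ennreal \<bar>\<Sum>t=1..T. \<integral>\<omega>. f (x t \<omega>, p t \<omega>) * (of_bool (y t \<omega> \<le> p t \<omega>) - q) \<partial>M\<bar>
          \<le> ennreal (rkhs_norm ip f) *
            ennreal_sqrt (ennreal L +
              (\<Sum>t=1..T. \<integral>\<^sup>+\<omega>. ennreal (k (x t \<omega>, p t \<omega>) (x t \<omega>, p t \<omega>)) \<partial>M)))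
     \<and>
     (\<forall>(\<Phi> :: 'x \<times> real \<Rightarrow> real ^ 'd) B v.
        (\<forall>z \<in> space X \<times> {Ymin..Ymax}. \<forall>z' \<in> space X \<times> {Ymin..Ymax}. k z z' = \<Phi> z \<bullet> \<Phi> z') \<longrightarrow>
        (\<forall>z \<in> space X \<times> {Ymin..Ymax}. (norm (\<Phi> z))\<^sup>2 \<le> B) \<longrightarrow>
        (\<forall>t\<in>{1..T}. integrable M
           (\<lambda>\<omega>. (v \<bullet> \<Phi> (x t \<omega>, p t \<omega>)) * (of_bool (y t \<omega> \<le> p t \<omega>) - q))) \<and>
        \<bar>\<Sum>t=1..T. \<integral>\<omega>. (v \<bullet> \<Phi> (x t \<omega>, p t \<omega>)) * (of_bool (y t \<omega> \<le> p t \<omega>) - q) \<partial>M\<bar>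
          \<le> norm v * sqrt (L + B * real T))"
proof -
  interpret ocqe_interaction M G F X Ymin Ymax T x Dp Dy p y H ip k q L
    using protocol rkhs
    by (rule ocqe_interaction.intro) (intro ocqe_interaction_axioms.intro q L k_measurable algorithm lipschitz)
  \<comment> \<open>\<open>kernel_integrable_iff\<close> translates the finiteness condition of the
    first claim into the integrability that \<open>integrable_test_function\<close> asks
    for.\<close>
  show ?thesis
    using regret_bound_ennreal integrable_test_function kernel_integrable_iff feature_regret_bound
    by (intro conjI ballI allI impI) blast+
qed

end
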